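(* Let $\varepsilon>0$ be fixed, and let $n$ range over multiples of $k$. Then: (i) For all integers $k\ge 3$ and $1\le \ell\le k/2$, if $p=(1-\varepsilon)\sqrt{e^{k}\,\ell!\,(k-\ell)!/n^{k}}$, then asymptotically almost surely $H_{n,p}^{(k)}$ is not $\ell$-offset Hamiltonian. (ii) For all integers $k\ge 6$ and $3\le \ell\le k/2$, if $p=(1+\varepsilon)\sqrt{e^{k}\,\ell!\,(k-\ell)!/n^{k}}$, then asymptotically almost surely $H_{n,p}^{(k)}$ is $\ell$-offset Hamiltonian. (iii) For all integers $k\ge 4$ and $\ell=2$, if $p=\omega/n^{k/2}$ where $\omega=\omega(n)$ is any function tending to infinity with $n$, then asymptotically almost surely $H_{n,p}^{(k)}$ is $2$-offset Hamiltonian.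
   Context: $H_{n,p}^{(k)}$ denotes the random $k$-uniform hypergraph on vertex set $[n]$ in which each of the $\binom{n}{k}$ possible $k$-element edges appears independently with probability $p$. "Asymptotically almost surely" means with probability tending to $1$ as $n\to\infty$; $e$ is the base of the natural logarithm. For $1\le \ell\le k/2$, an $\ell$-offset Hamilton cycle in a $k$-uniform hypergraph $H$ on $n$ vertices (with $k\mid n$) is a collection of $m=2n/k$ edges $E_1,\dots,E_m$ of $H$ such that for some cyclic ordering of the vertex set, each edge consists of $k$ consecutive vertices, and, indices taken cyclically, consecutive edges intersect alternately in $\ell$ and in $k-\ell$ vertices: $|E_{i-1}\cap E_i|=\ell$ and $|E_i\cap E_{i+1}|=k-\ell$ for alternating $i$ (equivalently, the cyclic order of the vertices is partitioned into consecutive blocks of sizes alternating $\ell,k-\ell,\ell,k-\ell,\dots$, and each edge is the union of two consecutive blocks). $H$ is $\ell$-offset Hamiltonian if it contains an $\ell$-offset Hamilton cycle. *)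

theory Defs
  imports "HOL-Probability.Product_PMF"
begin

definition complete_edges :: "nat \<Rightarrow> nat \<Rightarrow> nat set set" where
  "complete_edges k n = {e. e \<subseteq> {1..n} \<and> card e = k}"

(* The law of the edge set. Note that bernoulli_pmf truncates its parameter to [0,1]. *)
definition random_hypergraph :: "nat \<Rightarrow> nat \<Rightarrow> real \<Rightarrow> nat set set pmf" where
  "random_hypergraph k n p =
     map_pmf (\<lambda>f. {e \<in> complete_edges k n. f e})
       (Pi_pmf (complete_edges k n) False (\<lambda>_. bernoulli_pmf p))"

(* Blocks are numbered from 0; block i occupies the positions
   block_start k l i, ..., block_start k l (Suc i) - 1,
   so the block sizes are l, k - l, l, k - l, ... *)
definition block_start :: "nat \<Rightarrow> nat \<Rightarrow> nat \<Rightarrow> nat" where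
  "block_start k l i = (i div 2) * k + (if even i then 0 else l)"

definition offset_block :: "nat \<Rightarrow> nat \<Rightarrow> (nat \<Rightarrow> 'a) \<Rightarrow> nat \<Rightarrow> 'a set" where
  "offset_block k l v i = v ` {block_start k l i..<block_start k l (Suc i)}"

(* v 0, v 1, ..., v (n - 1) is the cyclic ordering of the n = card V vertices. *)
definition offset_hamilton_cycle :: "nat \<Rightarrow> nat \<Rightarrow> 'a set \<Rightarrow> 'a set set \<Rightarrow> bool" where
  "offset_hamilton_cycle k l V C \<longleftrightarrow>
     finite V \<and> k dvd card V \<and>
     (\<exists>v. bij_betw v {..<card V} V \<and>
        (let m = 2 * card V div k in
          C = (\<lambda>i. offset_block k l v i \<union> offset_block k l v (Suc i mod m)) ` {..<m}))"

definition offset_hamiltonian :: "nat \<Rightarrow> nat \<Rightarrow> 'a set \<Rightarrow> 'a set set \<Rightarrow> bool" where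
  "offset_hamiltonian k l V H \<longleftrightarrow> (\<exists>C. C \<subseteq> H \<and> offset_hamilton_cycle k l V C)"

definition multiples_at_top :: "nat \<Rightarrow> nat filter" where
  "multiples_at_top k = inf sequentially (principal {n. k dvd n})"

(* With high probability, as n tends to infinity through the multiples of k. *)
definition aas :: "nat \<Rightarrow> (nat \<Rightarrow> real) \<Rightarrow> (nat \<Rightarrow> nat set set \<Rightarrow> bool) \<Rightarrow> bool" where
  "aas k p Q \<longleftrightarrow>
     ((\<lambda>n. measure_pmf.prob (random_hypergraph k n (p n)) {H. Q n H}) \<longlongrightarrow> 1)
       (multiples_at_top k)"

lemma block_start_Suc:
  assumes "l \<le> k"
  shows "block_start k l (Suc i) = block_start k l i + (if even i then l else k - l)"
  using assms by (auto simp: block_start_def elim!: evenE oddE)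

lemma block_start_mono:
  assumes "l \<le> k" "i \<le> j"
  shows "block_start k l i \<le> block_start k l j"
  using assms(2) by (induction rule: dec_induct) (auto simp: block_start_Suc assms(1))

(* Consecutive edges meet alternately in k - l and l vertices. *)
lemma offset_edges_inter:
  fixes v :: "nat \<Rightarrow> 'a"
  assumes l: "1 \<le> l" "2 * l \<le> k" and V: "k dvd card V" "2 * k \<le> card V"
    and v: "bij_betw v {..<card V} V"
  defines "m \<equiv> 2 * card V div k"
  defines "E \<equiv> \<lambda>i. offset_block k l v i \<union> offset_block k l v (Suc i mod m)"
  assumes i: "i < m"
  shows "card (E i) = k"
    and "card (E i \<inter> E (Suc i mod m)) = (if even i then k - l else l)"
proof -
  obtain q where q: "card V = k * q" using V(1) by blast
  have k: "k > 0" using l by simp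
  have m: "m = 2 * q" unfolding m_def q using k by simp
  have q2: "q \<ge> 2" using V(2) k by (simp add: q)
  have lk: "l \<le> k" using l by simp
  have end_m: "block_start k l m = card V" by (simp add: block_start_def m q)
  have sub: "{block_start k l j..<block_start k l (Suc j)} \<subseteq> {..<card V}" if "j < m" for j
    using block_start_mono[OF lk, of "Suc j" m] that by (auto simp: end_m)
  have inj: "inj_on v {..<card V}" using v by (simp add: bij_betw_def)
  have cardB: "card (offset_block k l v j) = (if even j then l else k - l)" if "j < m" for j
    unfolding offset_block_def
    using card_image[OF inj_on_subset[OF inj sub[OF that]]] lk by (simp add: block_start_Suc)
  have fin: "finite (offset_block k l v j)" for j by (simp add: offset_block_def)
  have disj_less: "offset_block k l v a \<inter> offset_block k l v b = {}"
    if "a < b" "b < m" for a b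
  proof -
    have "{block_start k l a..<block_start k l (Suc a)} \<inter>
          {block_start k l b..<block_start k l (Suc b)} = {}"
      using block_start_mono[OF lk, of "Suc a" b] that by auto
    then show ?thesis
      unfolding offset_block_def
      using inj_on_image_Int[OF inj sub sub, of a b] that
      by (metis image_empty less_trans)
  qed
  have disj: "offset_block k l v a \<inter> offset_block k l v b = {}"
    if "a \<noteq> b" "a < m" "b < m" for a b
    using disj_less[of a b] disj_less[of b a] that by (cases "a < b") auto
  define j where "j = Suc i mod m"
  define r where "r = Suc j mod m"
  have jm: "j < m" and rm: "r < m" using i by (auto simp: j_def r_def)
  have jv: "j = (if Suc i = m then 0 else Suc i)" using i by (simp add: j_def)
  have rv: "r = (if Suc j = m then 0 else Suc j)" using jm by (simp add: r_def)
  have par: "even j \<longleftrightarrow> odd i" using jv m by (auto split: if_splits) (metis even_Suc dvd_triv_left)+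
  have ij: "i \<noteq> j" using par by auto
  have jr: "j \<noteq> r" using jv rv q2 m by (auto split: if_splits)
  have ir: "i \<noteq> r" using jv rv q2 m by (auto split: if_splits)
  show "card (E i) = k"
    unfolding E_def j_def[symmetric]
    using card_Un_disjoint[OF fin fin disj[OF ij i jm]] cardB i jm par lk by simp
  have "E i \<inter> E j = offset_block k l v j"
    unfolding E_def j_def[symmetric] r_def[symmetric]
    using disj[OF ij i jm] disj[OF ir i rm] disj[OF jr jm rm] by auto
  then show "card (E i \<inter> E (Suc i mod m)) = (if even i then k - l else l)"
    unfolding j_def[symmetric] using cardB[OF jm] par by simp
qed

end

(* Both moments are taken over the n! orderings of the vertices instead of the cycles.

   Below the threshold, the expected number of orderings whose cycle lies in H is n! p^(2n/k), and
   permuting vertices within the blocks turns one such ordering into (l! (k-l)!)^(n/k) of them, so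
   Markov's inequality and n! <= e n (n/e)^n suffice.

   Above the threshold, fix an ordering v and average p^(-|C(v) \<inter> C(w)|) over w. This is at most
   the sum, over all subsets S of C(v), of p^(-|S|) P(S \<subseteq> C(w)). A proper subset S splits into
   maximal arcs. An arc of b edges can be placed in C(w) in at most 4n/k ways, and a placement
   prescribes the images of its b + 1 blocks. Since the sizes of neighbouring blocks add up to k,
   the product of the block costs s!/(n/e)^s along the arc is, up to its two end blocks, the
   (b/2)-th power of l! (k-l)!/(n/e)^k. With 1/p = rho ((n/e)^k / (l! (k-l)!))^(1/2), an arc
   therefore contributes a factor O(n^(1-l) rho^b). As S is determined by its set of arcs, the sum
   is at most exp(O(n^(2-l)) (rho + rho^2 + ...)), which tends to 1 if l >= 3 and rho is bounded
   away from 1, or if l = 2 and rho tends to 0. The set S = C(v) is compared with an arc of one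
   edge less, at the price of a factor 1/p, which rho^(2n/k) absorbs. *)

theory Submission
  imports Defs
begin

subsection \<open>Counting bijections with prescribed images\<close>

text \<open>Extensionality fixes the values outside \<open>A\<close>, so each bijection is
  represented once and the set is finite.\<close>

definition bijs :: "'a set \<Rightarrow> 'b set \<Rightarrow> ('a \<Rightarrow> 'b) set" where
  "bijs A B = {w \<in> extensional A. bij_betw w A B}"

lemma finite_bijs: "finite A \<Longrightarrow> finite B \<Longrightarrow> finite (bijs A B)"
  by (rule finite_subset[of _ "A \<rightarrow>\<^sub>E B"])
    (auto simp: bijs_def bij_betw_def PiE_iff extensional_def intro!: finite_PiE)

text \<open>A bijection that maps \<open>P\<close> onto \<open>U\<close> is a pair of independent
  bijections, on \<open>P\<close> and on \<open>A - P\<close>. The other constraints live on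
  \<open>A - P\<close>, so only the second factor sees them; this allows induction over the
  prescribed images.\<close>

lemma card_bijs_split:
  assumes "P \<subseteq> A" "U \<subseteq> B" "\<And>x. x \<in> X \<Longrightarrow> R x \<subseteq> A - P"
  shows "card {w \<in> bijs A B. w ` P = U \<and> (\<forall>x\<in>X. w ` R x = T x)} =
         card (bijs P U) * card {w \<in> bijs (A - P) (B - U). \<forall>x\<in>X. w ` R x = T x}"
    (is "card ?L = card ?M * card ?N")
proof -
  let ?f = "\<lambda>w. (restrict w P, restrict w (A - P))"
  let ?g = "\<lambda>(f, g). \<lambda>x. if x \<in> P then f x else g x"
  have img: "(\<lambda>x. if x \<in> P then f x else g x) ` R x = g ` R x" if "x \<in> X" for x f g
    using assms(3)[OF that] by (intro image_cong) auto
  have imgr: "restrict w (A - P) ` R x = w ` R x" if "x \<in> X" for x w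
    using assms(3)[OF that] by (intro image_cong) auto
  have "bij_betw ?f ?L (?M \<times> ?N)"
  proof (rule bij_betw_byWitness[where f' = ?g])
    show "\<forall>w\<in>?L. ?g (?f w) = w"
      by (auto simp: bijs_def extensional_def fun_eq_iff)
    show "\<forall>w\<in>?M \<times> ?N. ?f (?g w) = w"
      by (auto simp: bijs_def extensional_def fun_eq_iff)
    show "?f ` ?L \<subseteq> ?M \<times> ?N"
    proof clarify
      fix w assume w: "w \<in> bijs A B" "U = w ` P" and c: "\<forall>x\<in>X. w ` R x = T x"
      have inj: "inj_on w A" and im: "w ` A = B" using w by (auto simp: bijs_def bij_betw_def)
      have "bij_betw (restrict w P) P U"
        unfolding bij_betw_restrict_eq using inj_on_subset[OF inj assms(1)] w(2) by (simp add: bij_betw_def)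
      moreover have "bij_betw (restrict w (A - P)) (A - P) (B - U)"
        unfolding bij_betw_restrict_eq bij_betw_def w(2) im[symmetric]
        using inj_on_subset[OF inj, of "A - P"] inj_on_image_set_diff[OF inj, of A P] assms(1) by auto
      moreover have "\<forall>x\<in>X. restrict w (A - P) ` R x = T x"
        using c imgr by metis
      ultimately show "restrict w P \<in> bijs P (w ` P) \<and>
          restrict w (A - P) \<in> {v \<in> bijs (A - P) (B - w ` P). \<forall>x\<in>X. v ` R x = T x}"
        using w(2) unfolding bijs_def mem_Collect_eq
        by (intro conjI ballI restrict_extensional) simp_all
    qed
    show "?g ` (?M \<times> ?N) \<subseteq> ?L"
    proof clarify
      fix f g assume f: "f \<in> bijs P U" and g: "g \<in> bijs (A - P) (B - U)"
        and c: "\<forall>x\<in>X. g ` R x = T x"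
      let ?h = "\<lambda>x. if x \<in> P then f x else g x"
      have hf: "?h ` P = f ` P" by auto
      have "bij_betw ?h (P \<union> (A - P)) (U \<union> (B - U))"
        using f g by (intro bij_betw_disjoint_Un) (auto simp: bijs_def)
      then have "bij_betw ?h A B"
        using assms by (simp add: Un_absorb1)
      moreover have "?h \<in> extensional A"
        using f g assms(1) by (auto simp: bijs_def extensional_def)
      moreover have "\<forall>x\<in>X. ?h ` R x = T x"
        using c img by metis
      moreover have "f ` P = U"
        using f by (simp add: bijs_def bij_betw_def)
      ultimately show "?h \<in> bijs A B \<and> ?h ` P = U \<and> (\<forall>x\<in>X. ?h ` R x = T x)"
        unfolding hf bijs_def by blast
    qed
  qed
  then show ?thesis by (simp add: bij_betw_same_card card_cartesian_product)
qed

lemma card_bijs: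
  fixes A :: "'a set"
  assumes "finite A" "finite B" "card A = card B"
  shows "card (bijs A B) = fact (card B)"
  using assms
proof (induction A arbitrary: B rule: finite_induct)
  case empty
  then have "bijs ({} :: 'a set) B = {\<lambda>_. undefined}" by (auto simp: bijs_def bij_betw_def)
  moreover have "B = {}" using empty by simp
  ultimately show ?case by simp
next
  case (insert a A)
  have single: "card (bijs {a} {b}) = 1" for b
  proof -
    have "bijs {a} {b} = {\<lambda>x\<in>{a}. b}"
      by (auto simp: bijs_def bij_betw_def extensional_def fun_eq_iff)
    then show ?thesis by simp
  qed
  \<comment> \<open>Split by the image of \<open>a\<close>. The vacuous condition over the empty
    index set brings each class into the form of \<open>card_bijs_split\<close>.\<close>
  have "bijs (insert a A) B = (\<Union>b\<in>B. {w \<in> bijs (insert a A) B. w ` {a} = {b} \<and> (\<forall>x\<in>{}. w ` {} = {})})"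
    by (auto simp: bijs_def bij_betw_def)
  then have "card (bijs (insert a A) B) =
      card (\<Union>b\<in>B. {w \<in> bijs (insert a A) B. w ` {a} = {b} \<and> (\<forall>x\<in>{}::nat set. w ` {} = {})})"
    by simp
  also have "\<dots> = (\<Sum>b\<in>B. card {w \<in> bijs (insert a A) B. w ` {a} = {b} \<and> (\<forall>x\<in>{}::nat set. w ` {} = {})})"
    using insert.prems insert.hyps
    by (intro card_UN_disjoint) (auto intro!: finite_subset[OF _ finite_bijs])
  also have "\<dots> = (\<Sum>b\<in>B. fact (card B - 1))"
  proof (rule sum.cong)
    fix b assume b: "b \<in> B"
    have "card (bijs A (B - {b})) = fact (card B - 1)"
      using insert b by (subst insert.IH) auto
    then show "card {w \<in> bijs (insert a A) B. w ` {a} = {b} \<and> (\<forall>x\<in>{}::nat set. w ` {} = {})} = fact (card B - 1)"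
      using b insert.hyps single by (subst card_bijs_split) auto
  qed simp
  also have "\<dots> = fact (card B)"
    using insert.prems insert.hyps by (simp add: fact_reduce)
  finally show ?case .
qed

text \<open>One prescribed image is split off at a time; the last factorial counts the bijections of
  what no prescription touches.\<close>

lemma card_bijs_images:
  assumes "finite X" "finite A" "finite B" "card A = card B"
    and "\<And>x. x \<in> X \<Longrightarrow> P x \<subseteq> A" "\<And>x. x \<in> X \<Longrightarrow> U x \<subseteq> B"
    and "\<And>x. x \<in> X \<Longrightarrow> card (P x) = card (U x)"
    and "disjoint_family_on P X" "disjoint_family_on U X"
  shows "card {w \<in> bijs A B. \<forall>x\<in>X. w ` P x = U x} =
         (\<Prod>x\<in>X. fact (card (U x))) * fact (card B - (\<Sum>x\<in>X. card (U x)))"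
  using assms
proof (induction X arbitrary: A B rule: finite_induct)
  case empty
  then show ?case by (simp add: card_bijs)
next
  case (insert y X)
  have fin: "finite (P y)" "finite (U y)"
    using insert.prems finite_subset by (metis insertI1)+
  have PR: "P x \<subseteq> A - P y" "U x \<subseteq> B - U y" if "x \<in> X" for x
  proof -
    have "x \<noteq> y" using that insert.hyps by auto
    then show "P x \<subseteq> A - P y" "U x \<subseteq> B - U y"
      using insert.prems(4,5)[of x] disjoint_family_onD[OF insert.prems(7), of x y]
        disjoint_family_onD[OF insert.prems(8), of x y] that by auto
  qed
  have "card {w \<in> bijs A B. \<forall>x\<in>insert y X. w ` P x = U x} =
        card {w \<in> bijs A B. w ` P y = U y \<and> (\<forall>x\<in>X. w ` P x = U x)}" by simp
  also have "\<dots> = card (bijs (P y) (U y)) * card {w \<in> bijs (A - P y) (B - U y). \<forall>x\<in>X. w ` P x = U x}"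
    using insert.prems PR by (intro card_bijs_split) auto
  also have "card {w \<in> bijs (A - P y) (B - U y). \<forall>x\<in>X. w ` P x = U x} =
     (\<Prod>x\<in>X. fact (card (U x))) * fact (card (B - U y) - (\<Sum>x\<in>X. card (U x)))"
    using insert.prems PR fin
    by (intro insert.IH) (auto simp: card_Diff_subset disjoint_family_on_def)
  also have "card (bijs (P y) (U y)) = fact (card (U y))"
    using fin insert.prems by (intro card_bijs) auto
  also have "card (B - U y) = card B - card (U y)"
    using fin insert.prems by (intro card_Diff_subset) auto
  finally show ?case using insert.hyps by (simp add: mult.assoc)
qed

section \<open>Factorial estimates\<close>

text \<open>This is \<open>n! / (n - v)! \<ge> (n / e)\<^sup>v\<close> with \<open>n = r + v\<close>.\<close>

lemma fact_falling_lower: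
  "(real (r + v) / exp 1) ^ v * fact r \<le> fact (r + v)"
proof (induction v)
  case (Suc v)
  \<comment> \<open>The induction keeps \<open>r\<close> fixed, so the base (r + v) / e grows as
    well. With x = r + v this costs (1 + 1/x)^v, at most e since v \<le> x, and is paid for by the
    additional e in the denominator.\<close>
  have step: "(real (r + Suc v)) ^ v \<le> exp 1 * real (r + v) ^ v"
  proof (cases "r + v = 0")
    case False
    let ?x = "real (r + v)"
    have x: "?x > 0" using False by (subst of_nat_0_less_iff) simp
    have "(1 + 1 / ?x) ^ v \<le> exp (1 / ?x) ^ v"
      by (intro power_mono) (use exp_ge_add_one_self x in auto)
    also have "\<dots> = exp (real v / ?x)" by (simp add: exp_of_nat_mult[symmetric])
    also have "\<dots> \<le> exp 1" using x by (simp add: divide_simps)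
    finally have "(1 + 1 / ?x) ^ v * ?x ^ v \<le> exp 1 * ?x ^ v"
      by (intro mult_right_mono) auto
    also have "(1 + 1 / ?x) ^ v * ?x ^ v = (real (r + Suc v)) ^ v"
      using x by (simp add: power_mult_distrib[symmetric] field_simps)
    finally show ?thesis .
  qed simp
  have "(real (r + Suc v) / exp 1) ^ Suc v * fact r =
        real (r + Suc v) / exp 1 ^ Suc v * (real (r + Suc v)) ^ v * fact r"
    by (simp add: power_divide)
  also have "\<dots> \<le> real (r + Suc v) / exp 1 ^ Suc v * (exp 1 * real (r + v) ^ v) * fact r"
    using step by (intro mult_right_mono mult_left_mono) auto
  also have "\<dots> = real (r + Suc v) * ((real (r + v) / exp 1) ^ v * fact r)"
    by (simp add: power_divide)
  also have "\<dots> \<le> real (r + Suc v) * fact (r + v)"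
    by (intro mult_left_mono Suc.IH) auto
  also have "\<dots> = fact (r + Suc v)" by simp
  finally show ?case .
qed simp

lemma fact_upper:
  assumes "n > 0"
  shows "fact n \<le> exp 1 * real n * (real n / exp 1) ^ n"
  using assms
proof (induction n rule: nat_induct_non_zero)
  case (Suc n)
  let ?x = "real n"
  have x: "?x > 0" using Suc by simp
  \<comment> \<open>The induction step amounts to e \<le> ((x + 1) / x)^(x + 1), obtained from ln y
    \<le> y - 1 at y = x / (x + 1).\<close>
  have "1 - ?x / (?x + 1) \<le> - ln (?x / (?x + 1))"
    using ln_le_minus_one[of "?x / (?x + 1)"] x by simp
  then have "1 / (?x + 1) \<le> ln ((?x + 1) / ?x)"
    using x by (simp add: ln_div field_simps)
  then have "1 \<le> (?x + 1) * ln ((?x + 1) / ?x)"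
    using x by (simp add: field_simps)
  also have "\<dots> = ln (((?x + 1) / ?x) ^ Suc n)"
    using x by (subst ln_realpow) auto
  finally have "exp 1 \<le> ((?x + 1) / ?x) ^ Suc n"
    using x by (subst (asm) ln_ge_iff) auto
  then have e: "exp 1 * ?x ^ Suc n \<le> (?x + 1) ^ Suc n"
    using x by (simp add: power_divide divide_simps split: if_splits)
  have "fact (Suc n) = (?x + 1) * fact n" by simp
  also have "\<dots> \<le> (?x + 1) * (exp 1 * ?x * (?x / exp 1) ^ n)"
    using Suc by (intro mult_left_mono) auto
  also have "\<dots> = exp 1 * (?x + 1) * (exp 1 * ?x ^ Suc n) / exp 1 ^ Suc n"
    by (simp add: power_divide field_simps)
  also have "\<dots> \<le> exp 1 * (?x + 1) * (?x + 1) ^ Suc n / exp 1 ^ Suc n"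
    using e by (intro divide_right_mono mult_left_mono) auto
  also have "\<dots> = exp 1 * real (Suc n) * (real (Suc n) / exp 1) ^ Suc n"
    by (simp add: power_divide add.commute)
  finally show ?case .
qed simp

subsection \<open>Moments of the number of contained edge sets\<close>

lemma finite_complete_edges: "finite (complete_edges k n)"
  unfolding complete_edges_def by (rule finite_subset[of _ "Pow {1..n}"]) auto

text \<open>The edge probabilities of the theorem may be negative, if \<epsilon> > 1, or exceed 1;
  this brings them into [0,1], where the moments are computed.\<close>

lemma bernoulli_pmf_clamp: "bernoulli_pmf p = bernoulli_pmf (min 1 (max 0 p))"
proof (rule pmf_eqI)
  fix b :: bool
  have "pmf (bernoulli_pmf x) b = (if b then min 1 (max 0 x) else 1 - min 1 (max 0 x))" for x
    by (simp add: bernoulli_pmf.rep_eq)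
  then show "pmf (bernoulli_pmf p) b = pmf (bernoulli_pmf (min 1 (max 0 p))) b"
    by simp
qed

lemma prob_edges_subset:
  assumes "A \<subseteq> complete_edges k n" "0 \<le> p" "p \<le> 1"
  shows "measure_pmf.prob (random_hypergraph k n p) {H. A \<subseteq> H} = p ^ card A"
proof -
  let ?E = "complete_edges k n"
  let ?B = "\<lambda>e. if e \<in> A then {True} else UNIV"
  have fin: "finite ?E" by (rule finite_complete_edges)
  have "measure_pmf.prob (random_hypergraph k n p) {H. A \<subseteq> H} =
        measure_pmf.prob (Pi_pmf ?E False (\<lambda>_. bernoulli_pmf p)) (Pi ?E ?B)"
    unfolding random_hypergraph_def measure_map_pmf
    by (rule arg_cong[where f = "measure_pmf.prob _"]) (use assms(1) in \<open>auto simp: Pi_def\<close>)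
  also have "\<dots> = (\<Prod>e\<in>?E. measure_pmf.prob (bernoulli_pmf p) (?B e))"
    by (rule measure_Pi_pmf_Pi[OF fin])
  also have "\<dots> = (\<Prod>e\<in>?E. if e \<in> A then p else 1)"
    using assms by (intro prod.cong) (auto simp: measure_pmf_single)
  also have "\<dots> = p ^ card A"
    using assms(1) fin by (simp add: prod.If_cases Int_absorb1)
  finally show ?thesis .
qed

text \<open>Markov's inequality for the number of \<open>w\<close> with \<open>C w\<close> in the
  hypergraph; \<open>c\<close> will be a lower bound for the number of orderings that share one
  cycle.\<close>

lemma prob_first_moment:
  assumes "finite W" "c > 0" "0 \<le> p" "p \<le> 1"
    and C: "\<And>w. w \<in> W \<Longrightarrow> C w \<subseteq> complete_edges k n" "\<And>w. w \<in> W \<Longrightarrow> card (C w) = m"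
    and many: "\<And>H. Q H \<Longrightarrow> c \<le> real (card {w \<in> W. C w \<subseteq> H})"
  shows "measure_pmf.prob (random_hypergraph k n p) {H. Q H} \<le> real (card W) * p ^ m / c"
proof -
  let ?M = "measure_pmf (random_hypergraph k n p)"
  let ?I = "\<lambda>w. indicator {H. C w \<subseteq> H} :: nat set set \<Rightarrow> real"
  have int: "integrable ?M (?I w)" for w
    by (rule measure_pmf.integrable_const_bound[where B = 1]) auto
  have "c * measure_pmf.prob (random_hypergraph k n p) {H. Q H} =
        measure_pmf.expectation (random_hypergraph k n p) (\<lambda>H. c * indicator {H. Q H} H)"
    by simp
  also have "\<dots> \<le> measure_pmf.expectation (random_hypergraph k n p) (\<lambda>H. \<Sum>w\<in>W. ?I w H)"
  proof (rule integral_mono)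
    show "integrable ?M (\<lambda>H. \<Sum>w\<in>W. ?I w H)" using int by simp
    show "integrable ?M (\<lambda>H. c * indicator {H. Q H} H)"
      by (rule measure_pmf.integrable_const_bound[where B = c]) (use \<open>c > 0\<close> in \<open>auto simp: indicator_def\<close>)
    fix H
    have "(\<Sum>w\<in>W. ?I w H) = real (card {w \<in> W. C w \<subseteq> H})"
      using \<open>finite W\<close> by (simp add: indicator_def sum.If_cases Int_def)
    then show "c * indicator {H. Q H} H \<le> (\<Sum>w\<in>W. ?I w H)"
      using many by (auto simp: indicator_def)
  qed
  also have "\<dots> = (\<Sum>w\<in>W. measure_pmf.prob (random_hypergraph k n p) {H. C w \<subseteq> H})"
    using int by (simp add: Bochner_Integration.integral_sum)
  also have "\<dots> = real (card W) * p ^ m"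
    using C assms by (simp add: prob_edges_subset)
  finally show ?thesis using \<open>c > 0\<close> by (simp add: field_simps)
qed

text \<open>Chebyshev's inequality. The probability that \<open>C v\<close> and \<open>C w\<close>
  both occur is p^(2m) (1/p)^|C v \<inter> C w|, so a bound on the inner sum for each fixed
  \<open>v\<close> compares the second moment with the square of the mean.\<close>

lemma prob_second_moment:
  assumes W: "finite W" "W \<noteq> {}" and p: "0 < p" "p \<le> 1"
    and C: "\<And>w. w \<in> W \<Longrightarrow> C w \<subseteq> complete_edges k n" "\<And>w. w \<in> W \<Longrightarrow> card (C w) = m"
    and pairs: "\<And>v. v \<in> W \<Longrightarrow> (\<Sum>w\<in>W. (1 / p) ^ card (C v \<inter> C w)) \<le> real (card W) * (1 + \<delta>)"
  shows "measure_pmf.prob (random_hypergraph k n p) {H. \<exists>w\<in>W. C w \<subseteq> H} \<ge> 1 - \<delta>"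
proof -
  let ?P = "measure_pmf.prob (random_hypergraph k n p)"
  let ?M = "measure_pmf (random_hypergraph k n p)"
  let ?I = "\<lambda>w. indicator {H. C w \<subseteq> H} :: nat set set \<Rightarrow> real"
  let ?J = "\<lambda>v w. indicator {H. C v \<subseteq> H \<and> C w \<subseteq> H} :: nat set set \<Rightarrow> real"
  let ?N = "{H. \<not> (\<exists>w\<in>W. C w \<subseteq> H)}"
  define \<mu> where "\<mu> = real (card W) * p ^ m"
  have \<mu>: "\<mu> > 0" using W p by (simp add: \<mu>_def card_gt_0_iff)
  have int: "integrable ?M (indicator S :: nat set set \<Rightarrow> real)" for S
    by (rule measure_pmf.integrable_const_bound[where B = 1]) auto
  have sq: "((\<Sum>w\<in>W. ?I w H) - \<mu>)\<^sup>2 = (\<Sum>v\<in>W. \<Sum>w\<in>W. ?J v w H) - 2 * \<mu> * (\<Sum>w\<in>W. ?I w H) + \<mu>\<^sup>2" for H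
  proof -
    have "(\<Sum>w\<in>W. ?I w H)\<^sup>2 = (\<Sum>v\<in>W. \<Sum>w\<in>W. ?J v w H)"
      by (simp add: power2_eq_square sum_product) (intro sum.cong refl, auto simp: indicator_def)
    then show ?thesis by (simp add: power2_diff algebra_simps)
  qed
  have fin: "finite (C w)" if "w \<in> W" for w
    using C(1)[OF that] finite_complete_edges finite_subset by blast
  \<comment> \<open>Where no \<open>C w\<close> occurs, the count is 0 and its squared distance from
    the mean \<mu> is the square of \<mu>.\<close>
  have "\<mu>\<^sup>2 * ?P ?N = measure_pmf.expectation (random_hypergraph k n p) (\<lambda>H. \<mu>\<^sup>2 * indicator ?N H)"
    by simp
  also have "\<dots> \<le> measure_pmf.expectation (random_hypergraph k n p) (\<lambda>H. ((\<Sum>w\<in>W. ?I w H) - \<mu>)\<^sup>2)"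
  proof (rule integral_mono)
    show "integrable ?M (\<lambda>H. \<mu>\<^sup>2 * indicator ?N H)" using int by simp
    show "integrable ?M (\<lambda>H. ((\<Sum>w\<in>W. ?I w H) - \<mu>)\<^sup>2)" unfolding sq using int by simp
    fix H
    have "(\<Sum>w\<in>W. ?I w H) = 0" if "H \<in> ?N" using that by (intro sum.neutral) auto
    then show "\<mu>\<^sup>2 * indicator ?N H \<le> ((\<Sum>w\<in>W. ?I w H) - \<mu>)\<^sup>2"
      by (cases "H \<in> ?N") auto
  qed
  also have "\<dots> = (\<Sum>v\<in>W. \<Sum>w\<in>W. ?P {H. C v \<subseteq> H \<and> C w \<subseteq> H}) - 2 * \<mu> * (\<Sum>w\<in>W. ?P {H. C w \<subseteq> H}) + \<mu>\<^sup>2"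
    unfolding sq using int by (simp add: Bochner_Integration.integral_sum)
  also have "(\<Sum>w\<in>W. ?P {H. C w \<subseteq> H}) = \<mu>"
    using C p by (simp add: prob_edges_subset \<mu>_def)
  also have "(\<Sum>v\<in>W. \<Sum>w\<in>W. ?P {H. C v \<subseteq> H \<and> C w \<subseteq> H}) =
             (\<Sum>v\<in>W. p ^ (2 * m) * (\<Sum>w\<in>W. (1 / p) ^ card (C v \<inter> C w)))"
    unfolding sum_distrib_left
  proof (intro sum.cong refl)
    fix v w assume vw: "v \<in> W" "w \<in> W"
    have "card (C v \<union> C w) + card (C v \<inter> C w) = 2 * m"
      using card_Un_Int[OF fin fin, of v w] C vw by simp
    then have "p ^ (2 * m) = p ^ card (C v \<union> C w) * p ^ card (C v \<inter> C w)"
      by (simp add: power_add[symmetric])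
    then show "?P {H. C v \<subseteq> H \<and> C w \<subseteq> H} = p ^ (2 * m) * (1 / p) ^ card (C v \<inter> C w)"
      using C vw p unfolding Un_subset_iff[symmetric]
      by (subst prob_edges_subset) (auto simp: power_divide)
  qed
  also have "\<dots> \<le> (\<Sum>v\<in>W. p ^ (2 * m) * (real (card W) * (1 + \<delta>)))"
    using p by (intro sum_mono mult_left_mono pairs) auto
  also have "\<dots> = \<mu>\<^sup>2 * (1 + \<delta>)"
    unfolding \<mu>_def power2_eq_square mult_2 power_add by simp
  finally have "\<mu>\<^sup>2 * ?P ?N \<le> \<mu>\<^sup>2 * \<delta>" by (simp add: algebra_simps power2_eq_square)
  then have "?P ?N \<le> \<delta>" using \<mu> by simp
  moreover have "?P ?N = 1 - ?P {H. \<exists>w\<in>W. C w \<subseteq> H}"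
    by (subst measure_pmf.prob_compl[symmetric]) (auto intro!: arg_cong[where f = ?P])
  ultimately show ?thesis by simp
qed

subsection \<open>Cyclic sequences of blocks\<close>

text \<open>The indices are all integers, read modulo \<open>m\<close>, so that paths of edges may
  run past the wrap-around and in either direction.\<close>

definition block_cycle :: "int \<Rightarrow> (int \<Rightarrow> 'a set) \<Rightarrow> bool" where
  "block_cycle m B \<longleftrightarrow> (\<forall>i. B i \<noteq> {}) \<and> (\<forall>i j. m dvd i - j \<longrightarrow> B i = B j) \<and>
     (\<forall>i j. B i \<inter> B j \<noteq> {} \<longrightarrow> m dvd i - j)"

definition edge :: "(int \<Rightarrow> 'a set) \<Rightarrow> int \<Rightarrow> 'a set" where
  "edge B i = B i \<union> B (i + 1)"

lemma block_cycleD: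
  assumes "block_cycle m B"
  shows "B i \<noteq> {}" "m dvd i - j \<Longrightarrow> B i = B j" "B i \<inter> B j \<noteq> {} \<Longrightarrow> m dvd i - j"
  using assms unfolding block_cycle_def by blast+

text \<open>Excludes coincidences between nearby indices caused by the wrap-around.\<close>

lemma not_dvd_small:
  fixes m i :: int
  assumes "m \<ge> 4" "i \<in> {-3, -2, -1, 1, 2, 3}"
  shows "\<not> m dvd i"
  using assms zdvd_not_zless[of i m] zdvd_not_zless[of "-i" m] by auto

lemma edge_cong:
  assumes "block_cycle m B" "m dvd i - j"
  shows "edge B i = edge B j"
proof -
  have "B i = B j" by (rule block_cycleD(2)[OF assms])
  moreover have "B (i + 1) = B (j + 1)"
    by (rule block_cycleD(2)[OF assms(1)]) (use assms(2) in simp)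
  ultimately show ?thesis by (simp add: edge_def)
qed

lemma edge_meet:
  assumes "block_cycle m B" "edge B i \<inter> edge B j \<noteq> {}"
  shows "m dvd i - j \<or> m dvd i - (j + 1) \<or> m dvd i - (j - 1)"
proof -
  have D: "m dvd x - y" if "B x \<inter> B y \<noteq> {}" for x y
    using block_cycleD(3)[OF assms(1) that] .
  from assms(2) consider "B i \<inter> B j \<noteq> {}" | "B i \<inter> B (j + 1) \<noteq> {}"
    | "B (i + 1) \<inter> B j \<noteq> {}" | "B (i + 1) \<inter> B (j + 1) \<noteq> {}"
    unfolding edge_def by blast
  then show ?thesis
    by cases (use D in \<open>force simp: algebra_simps\<close>)+
qed

text \<open>If two edges agree, their blocks match either straight or crosswise; a crosswise match
  would make \<open>m\<close> divide 2.\<close>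

lemma edge_eq_iff:
  assumes B: "block_cycle m B" and m: "m \<ge> 4"
  shows "edge B i = edge B j \<longleftrightarrow> m dvd i - j"
proof
  assume eq: "edge B i = edge B j"
  have D: "m dvd x - y" if "B x \<inter> B y \<noteq> {}" for x y
    using block_cycleD(3)[OF B that] .
  have ne: "B x \<noteq> {}" for x by (rule block_cycleD(1)[OF B])
  have "B i \<inter> B j \<noteq> {} \<or> B i \<inter> B (j + 1) \<noteq> {}"
    using eq ne[of i] unfolding edge_def by blast
  then have 1: "m dvd i - j \<or> m dvd i - (j + 1)" using D by blast
  have "B (i + 1) \<inter> B j \<noteq> {} \<or> B (i + 1) \<inter> B (j + 1) \<noteq> {}"
    using eq ne[of "i + 1"] unfolding edge_def by blast
  then have 2: "m dvd i + 1 - j \<or> m dvd i + 1 - (j + 1)" using D by blast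
  show "m dvd i - j"
  proof (rule ccontr)
    assume "\<not> m dvd i - j"
    then have "m dvd i - (j + 1)" "m dvd i + 1 - j" using 1 2 by auto
    then have "m dvd (i + 1 - j) - (i - (j + 1))" by (rule dvd_diff[rotated])
    then show False using not_dvd_small[OF m, of 2] by simp
  qed
qed (use edge_cong[OF B] in auto)

lemma edge_Int:
  assumes B: "block_cycle m B" and m: "m \<ge> 4"
  shows "edge B i \<inter> edge B (i + 1) = B (i + 1)"
    and "edge B i - B (i + 1) = B i" "edge B i - B i = B (i + 1)"
proof -
  have D: "B x \<inter> B y = {}" if "x - y \<in> {-2, -1, 1, 2}" for x y
  proof -
    have "\<not> m dvd x - y" by (rule not_dvd_small[OF m]) (use that in auto)
    then show ?thesis using block_cycleD(3)[OF B] by blast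
  qed
  have "B i \<inter> B (i + 1) = {}" "B i \<inter> B (i + 1 + 1) = {}" "B (i + 1) \<inter> B (i + 1 + 1) = {}"
    by (intro D; simp)+
  then show "edge B i \<inter> edge B (i + 1) = B (i + 1)"
    and "edge B i - B (i + 1) = B i" "edge B i - B i = B (i + 1)"
    unfolding edge_def by blast+
qed

text \<open>A path of edges common to two block cycles is traversed monotonically in the second one:
  consecutive edges meet, hence their indices differ by \<open>\<plusminus>1\<close>, and turning back would
  repeat an edge.\<close>

lemma arc_placement:
  assumes F: "block_cycle m F" and G: "block_cycle m G" and m: "m \<ge> 4"
    and "\<forall>i<b. edge F (s + int i) \<in> range (edge G)"
  shows "\<exists>t\<in>{0..<m}. \<exists>d\<in>{1, -1}. \<forall>i<b. edge F (s + int i) = edge G (t + d * int i)"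
proof -
  have "\<exists>t. \<exists>d\<in>{1, -1}. \<forall>i<b. edge F (s + int i) = edge G (t + d * int i)"
    using assms(4)
  proof (induction b)
    case 0
    then show ?case by auto
  next
    case (Suc b)
    have "\<exists>t. \<exists>d\<in>{1, -1}. \<forall>i<b. edge F (s + int i) = edge G (t + d * int i)"
      by (rule Suc.IH) (use Suc.prems in auto)
    then obtain t d where d: "d \<in> {1, -1}" and t: "\<forall>i<b. edge F (s + int i) = edge G (t + d * int i)"
      by blast
    obtain y where y: "edge F (s + int b) = edge G y" using Suc.prems by auto
    show ?case
    proof (cases b)
      case 0
      then show ?thesis using y by (intro exI[of _ y] bexI[of _ 1]) auto
    next
      case (Suc a)
      have a: "edge F (s + int a) = edge G (t + d * int a)" using t Suc by simp
      have "edge F (s + int b) \<inter> edge F (s + int a) \<noteq> {}"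
        using edge_Int(1)[OF F m, of "s + int a"] block_cycleD(1)[OF F, of "s + int b"] Suc
        by (simp add: Int_commute add.assoc add.commute[of 1])
      then have "m dvd y - (t + d * int a) \<or> m dvd y - (t + d * int a + 1) \<or> m dvd y - (t + d * int a - 1)"
        unfolding y a by (rule edge_meet[OF G])
      moreover have "\<not> m dvd y - (t + d * int a)"
      proof
        assume "m dvd y - (t + d * int a)"
        then have "edge F (s + int b) = edge F (s + int a)" unfolding y a by (rule edge_cong[OF G])
        then have "m dvd 1" using edge_eq_iff[OF F m] Suc by simp
        then show False using not_dvd_small[OF m, of 1] by simp
      qed
      ultimately have "m dvd y - (t + d * int b) \<or> m dvd y - (t + d * (int a - 1))"
        using d Suc by (auto simp: algebra_simps)
      then show ?thesis
      proof
        assume "m dvd y - (t + d * int b)"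
        then have "edge F (s + int b) = edge G (t + d * int b)" unfolding y by (rule edge_cong[OF G])
        then show ?thesis using t d by (intro exI[of _ t] bexI[of _ d]) (auto simp: less_Suc_eq)
      next
        assume turn: "m dvd y - (t + d * (int a - 1))"
        show ?thesis
        \<comment> \<open>Stepping back: if only one edge has been placed, the direction is still
          free and is reversed; otherwise edge \<open>b\<close> would repeat edge
          \<open>b - 2\<close>, so that \<open>m\<close> would divide 2.\<close>
        proof (cases a)
          case 0
          have "edge F (s + int b) = edge G (t - d)"
            unfolding y by (rule edge_cong[OF G]) (use turn 0 in \<open>simp add: algebra_simps\<close>)
          then show ?thesis using a d 0 Suc
            by (intro exI[of _ t] bexI[of _ "-d"]) (auto simp: less_Suc_eq)
        next
          case (Suc c)
          then have "edge F (s + int c) = edge G (t + d * (int a - 1))"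
            using t \<open>b = Suc a\<close> by simp
          also have "\<dots> = edge F (s + int b)"
            unfolding y using turn by (intro edge_cong[OF G]) (simp add: dvd_diff_commute)
          finally have "m dvd -2" using edge_eq_iff[OF F m] Suc \<open>b = Suc a\<close> by simp
          then show ?thesis using not_dvd_small[OF m, of "-2"] by simp
        qed
      qed
    qed
  qed
  then obtain t d where d: "d \<in> {1, -1}" and t: "\<forall>i<b. edge F (s + int i) = edge G (t + d * int i)"
    by blast
  \<comment> \<open>Reducing \<open>t\<close> modulo \<open>m\<close> leaves \<open>m\<close>
    possible starts, which makes the placements countable.\<close>
  have "edge G (t + x) = edge G (t mod m + x)" for x
    by (rule edge_cong[OF G]) (simp add: minus_mod_eq_mult_div)
  then show ?thesis
    using t d m by (intro bexI[of _ "t mod m"] bexI[of _ d]) auto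
qed

text \<open>The edge with index \<open>t - i\<close> consists of the blocks \<open>t - i\<close> and \<open>t - i + 1\<close>, so
  traversing backwards shifts the block indices by one.\<close>

definition block_place :: "int \<Rightarrow> int \<Rightarrow> nat \<Rightarrow> int" where
  "block_place t d j = (if d = 1 then t + int j else t + 1 - int j)"

text \<open>An inner block is the intersection of two consecutive edges, and an end block is what
  the end edge has besides its inner block. Both need two edges, hence
  \<open>2 \<le> b\<close>.\<close>

lemma arc_blocks:
  assumes F: "block_cycle m F" and G: "block_cycle m G" and m: "m \<ge> 4"
    and d: "d \<in> {1, -1}" and b: "2 \<le> b"
    and eq: "\<forall>i<b. edge F (s + int i) = edge G (t + d * int i)"
    and j: "j \<le> b"
  shows "F (s + int j) = G (block_place t d j)"
proof -
  have inner: "F (s + int i) = G (block_place t d i)" if i: "1 \<le> i" "i < b" for i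
  proof -
    obtain a where a: "i = Suc a" using i by (cases i) auto
    have "F (s + int i) = edge F (s + int a) \<inter> edge F (s + int i)"
      using edge_Int(1)[OF F m, of "s + int a"] a by (simp add: algebra_simps)
    also have "\<dots> = edge G (t + d * int a) \<inter> edge G (t + d * int i)"
      using eq[rule_format, of a] eq[rule_format, of i] i a by simp
    also have "\<dots> = G (block_place t d i)"
      using d edge_Int(1)[OF G m, of "t + int a"] edge_Int(1)[OF G m, of "t - int i"] a
      by (auto simp: block_place_def algebra_simps)
    finally show ?thesis .
  qed
  consider "j = 0" | "1 \<le> j" "j < b" | "j = b" using j by linarith
  then show ?thesis
  proof cases
    case 1
    have "F s = edge F s - F (s + 1)" using edge_Int(2)[OF F m] by simp
    also have "\<dots> = edge G t - G (block_place t d 1)"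
      using eq inner[of 1] b by (auto dest!: spec[of _ 0])
    also have "\<dots> = G (block_place t d 0)"
      using d edge_Int(2,3)[OF G m] by (auto simp: block_place_def)
    finally show ?thesis using 1 by simp
  next
    case 2
    then show ?thesis by (rule inner)
  next
    case 3
    obtain a where a: "b = Suc a" using b by (cases b) auto
    have "F (s + int b) = edge F (s + int a) - F (s + int a)"
      using edge_Int(3)[OF F m, of "s + int a"] a by (simp add: algebra_simps)
    also have "\<dots> = edge G (t + d * int a) - G (block_place t d a)"
      using eq inner[of a] a b by auto
    also have "\<dots> = G (block_place t d b)"
      using d a edge_Int(2,3)[OF G m, of "t + d * int a"]
      by (auto simp: block_place_def algebra_simps)
    finally show ?thesis using 3 by simp
  qed
qed

section \<open>Maximal arcs of a set of edge indices\<close>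

text \<open>The maximal arcs of \<open>S\<close> in the cyclic group of order \<open>m\<close>, as pairs of a start and a length.\<close>

definition arcs :: "int \<Rightarrow> int set \<Rightarrow> (int \<times> nat) set" where
  "arcs m S = {(s, b). s \<in> S \<and> (s - 1) mod m \<notin> S \<and>
     (\<forall>i<b. (s + int i) mod m \<in> S) \<and> (s + int b) mod m \<notin> S}"

lemma arcs_length:
  assumes "(s, b) \<in> arcs m S" "S \<subseteq> {0..<m}"
  shows "0 \<le> s" "s < m" "1 \<le> b" "int b < m"
proof -
  have s: "s \<in> S" using assms by (simp add: arcs_def)
  then show "0 \<le> s" "s < m" using assms(2) by auto
  then have "s mod m = s" by simp
  with assms(1) s show "1 \<le> b" by (cases b) (auto simp: arcs_def)
  \<comment> \<open>From \<open>s\<close>, m - 1 steps forward lead to the predecessor of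
    \<open>s\<close>, which is missing from \<open>S\<close>; so an arc has at most m - 1
    edges.\<close>
  have "(s + int (nat (m - 1))) mod m = (s - 1) mod m"
    using \<open>0 \<le> s\<close> \<open>s < m\<close> by (simp add: mod_eq_dvd_iff)
  then have "\<not> nat (m - 1) < b" using assms(1) by (auto simp: arcs_def)
  then show "int b < m" using \<open>0 \<le> s\<close> \<open>s < m\<close> by linarith
qed

text \<open>Walking back from \<open>x\<close> to the first missing index finds the start of the
  arc; walking forward from there finds its length. Both searches stop because \<open>S\<close>
  misses some \<open>y\<close>.\<close>

lemma arcs_cover:
  assumes S: "S \<subseteq> {0..<m}" "S \<noteq> {0..<m}" and x: "x \<in> S"
  shows "\<exists>(s, b)\<in>arcs m S. \<exists>i<b. (s + int i) mod m = x"
proof -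
  obtain y where y: "y \<in> {0..<m}" "y \<notin> S" using S by blast
  have m: "m > 0" using y by auto
  have xm: "x mod m = x" using x S by auto
  let ?Q = "\<lambda>j. (x - int j) mod m \<notin> S"
  have "(x - (x - y) mod m) mod m = y" using y by (simp add: mod_diff_right_eq)
  then have "?Q (nat ((x - y) mod m))" using y m by simp
  then have Q: "?Q (LEAST j. ?Q j)" by (rule LeastI)
  have "(LEAST j. ?Q j) \<noteq> 0"
    using Q x xm by (metis diff_zero of_nat_0)
  then obtain j where j: "(LEAST j. ?Q j) = Suc j" by (cases "LEAST j. ?Q j") auto
  have before: "(x - int i) mod m \<in> S" if "i \<le> j" for i
    using not_less_Least[of i ?Q] that j by auto
  define s where "s = (x - int j) mod m"
  have s: "s \<in> S" "(s - 1) mod m \<notin> S"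
    using before[of j] Q j by (simp_all add: s_def mod_diff_left_eq algebra_simps)
  let ?R = "\<lambda>b. (s + int b) mod m \<notin> S"
  have "(s + (y - s) mod m) mod m = y" using y by (simp add: mod_add_right_eq)
  then have "?R (nat ((y - s) mod m))" using y m by simp
  then have R: "?R (LEAST b. ?R b)" by (rule LeastI)
  have Rl: "(s + int i) mod m \<in> S" if "i < (LEAST b. ?R b)" for i
    using not_less_Least[of i ?R] that by auto
  have sx: "(s + int i) mod m = (x - (int j - int i)) mod m" for i
    unfolding s_def mod_add_left_eq by (simp add: algebra_simps)
  \<comment> \<open>The walk back met only members of \<open>S\<close> between the start and
    \<open>x\<close>, so the forward walk gets past \<open>x\<close>.\<close>
  have "j < (LEAST b. ?R b)"
  proof (rule ccontr)
    assume "\<not> j < (LEAST b. ?R b)"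
    then have "(s + int (LEAST b. ?R b)) mod m = (x - int (j - (LEAST b. ?R b))) mod m"
      by (simp add: sx of_nat_diff)
    also have "\<dots> \<in> S" by (rule before) simp
    finally show False using R by simp
  qed
  moreover have "(s + int j) mod m = x" using sx[of j] xm by simp
  moreover have "(s, LEAST b. ?R b) \<in> arcs m S"
    using s R Rl by (auto simp: arcs_def)
  ultimately show ?thesis by blast
qed

text \<open>Cancelling \<open>i\<close> puts \<open>s\<close> at position \<open>i' - i\<close> of
  the second arc. If that were positive, the predecessor of \<open>s\<close>, which is not in
  \<open>S\<close>, would be an edge of that arc.\<close>

lemma arcs_separated_aux:
  assumes a: "(s, b) \<in> arcs m S" "(s', b') \<in> arcs m S" and S: "S \<subseteq> {0..<m}"
    and ij: "i \<le> i'" "i' \<le> b'"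
    and eq: "(s + int i) mod m = (s' + int i') mod m"
  shows "s = s' \<and> i = i'"
proof -
  have "m dvd (s + int i) - (s' + int i')" using eq by (simp add: mod_eq_dvd_iff)
  then have D: "m dvd s - (s' + int (i' - i))" using ij by (simp add: of_nat_diff algebra_simps)
  show ?thesis
  proof (cases "i' - i")
    case 0
    have "s mod m = s' mod m" using D 0 by (simp add: mod_eq_dvd_iff)
    then have "s = s'" using arcs_length(1,2)[OF a(1) S] arcs_length(1,2)[OF a(2) S] by simp
    then show ?thesis using 0 ij by simp
  next
    case (Suc c)
    have "(s - 1) mod m = (s' + int c) mod m"
      using D Suc by (simp add: mod_eq_dvd_iff algebra_simps)
    moreover have "c < b'" using Suc ij by simp
    ultimately show ?thesis using a by (auto simp: arcs_def)
  qed
qed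

lemma arcs_unique:
  assumes "(s, b) \<in> arcs m S" "(s, b') \<in> arcs m S"
  shows "b = b'"
  using assms unfolding arcs_def by (cases b b' rule: linorder_cases) auto

text \<open>The range \<open>{..b}\<close> includes \<open>b\<close> because \<open>b\<close> edges
  use \<open>b + 1\<close> blocks. A missing edge follows every arc, so different arcs do not even
  share an end block; this makes the prescribed images disjoint.\<close>

lemma arcs_separated:
  assumes S: "S \<subseteq> {0..<m}"
  shows "inj_on (\<lambda>((s, b), i). (s + int i) mod m) (Sigma (arcs m S) (\<lambda>(s, b). {..b}))"
proof (rule inj_onI)
  fix x y
  assume x: "x \<in> Sigma (arcs m S) (\<lambda>(s, b). {..b})" and y: "y \<in> Sigma (arcs m S) (\<lambda>(s, b). {..b})"
    and xy: "(\<lambda>((s, b), i). (s + int i) mod m) x = (\<lambda>((s, b), i). (s + int i) mod m) y"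
  obtain s b i s' b' i' where xd: "x = ((s, b), i)" and yd: "y = ((s', b'), i')"
    by (metis prod.collapse)
  have a: "(s, b) \<in> arcs m S" "(s', b') \<in> arcs m S" and i: "i \<le> b" "i' \<le> b'"
    and eq: "(s + int i) mod m = (s' + int i') mod m"
    using x y xy by (auto simp: xd yd)
  have "s = s' \<and> i = i'"
  proof (cases "i \<le> i'")
    case True
    then show ?thesis using arcs_separated_aux[OF a S True _ eq] i by auto
  next
    case False
    then show ?thesis using arcs_separated_aux[OF a(2,1) S _ _ eq[symmetric]] i by auto
  qed
  then show "x = y" using arcs_unique a unfolding xd yd by blast
qed

text \<open>A proper subset is the union of its arcs. The full set is excluded because it has no
  arcs, like the empty set.\<close>

lemma inj_on_arcs: "inj_on (arcs m) {S. S \<subseteq> {0..<m} \<and> S \<noteq> {0..<m}}"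
proof (rule inj_onI)
  have *: "S = {x. \<exists>(s, b)\<in>arcs m S. \<exists>i<b. (s + int i) mod m = x}"
    if "S \<in> {S. S \<subseteq> {0..<m} \<and> S \<noteq> {0..<m}}" for S
  proof (intro equalityI subsetI)
    fix x assume "x \<in> S"
    then show "x \<in> {x. \<exists>(s, b)\<in>arcs m S. \<exists>i<b. (s + int i) mod m = x}"
      using arcs_cover[of S m x] that by auto
  next
    fix x assume "x \<in> {x. \<exists>(s, b)\<in>arcs m S. \<exists>i<b. (s + int i) mod m = x}"
    then show "x \<in> S" by (auto simp: arcs_def)
  qed
  fix S T assume "S \<in> {S. S \<subseteq> {0..<m} \<and> S \<noteq> {0..<m}}" "T \<in> {S. S \<subseteq> {0..<m} \<and> S \<noteq> {0..<m}}"
    "arcs m S = arcs m T"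
  then show "S = T" using *[of S] *[of T] by metis
qed

lemma card_le_sum_arcs:
  assumes S: "S \<subseteq> {0..<m}" "S \<noteq> {0..<m}" and fin: "finite (arcs m S)"
  shows "card S \<le> (\<Sum>(s, b)\<in>arcs m S. b)"
proof -
  let ?D = "Sigma (arcs m S) (\<lambda>(s, b). {..<b})"
  have "S \<subseteq> (\<lambda>((s, b), i). (s + int i) mod m) ` ?D"
  proof
    fix x assume "x \<in> S"
    then obtain s b i where "(s, b) \<in> arcs m S" "i < b" "(s + int i) mod m = x"
      using arcs_cover[OF S] by blast
    then show "x \<in> (\<lambda>((s, b), i). (s + int i) mod m) ` ?D"
      by (intro image_eqI[of _ _ "((s, b), i)"]) auto
  qed
  moreover have "finite ?D" using fin by auto
  ultimately have "card S \<le> card ?D" by (rule surj_card_le[rotated])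
  also have "\<dots> = (\<Sum>(s, b)\<in>arcs m S. b)"
    using fin by (simp add: case_prod_unfold)
  finally show ?thesis .
qed

text \<open>The sets \<open>P\<close> will come from arbitrary placements, which may overlap or have
  wrong sizes. A single solution transfers sizes and disjointness from \<open>U\<close> to
  \<open>P\<close>, so that the exact count applies; without a solution the bound is
  trivial.\<close>

lemma card_bijs_images_le:
  assumes "finite X" "finite A" "finite B" "card A = card B"
    and P: "\<And>x. x \<in> X \<Longrightarrow> P x \<subseteq> A" and U: "disjoint_family_on U X"
  shows "card {w \<in> bijs A B. \<forall>x\<in>X. w ` P x = U x} \<le>
         (\<Prod>x\<in>X. fact (card (U x))) * fact (card B - (\<Sum>x\<in>X. card (U x)))"
proof (cases "{w \<in> bijs A B. \<forall>x\<in>X. w ` P x = U x} = {}")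
  case False
  then obtain w where w: "w \<in> bijs A B" and im: "\<And>x. x \<in> X \<Longrightarrow> w ` P x = U x" by blast
  have inj: "inj_on w A" and wB: "w ` A = B" using w by (auto simp: bijs_def bij_betw_def)
  have "U x \<subseteq> B" "card (P x) = card (U x)" if "x \<in> X" for x
    using im[OF that, symmetric] P[OF that] wB card_image[OF inj_on_subset[OF inj P[OF that]]] by auto
  moreover have "disjoint_family_on P X"
    unfolding disjoint_family_on_def
  proof (intro ballI impI)
    fix x y assume "x \<in> X" "y \<in> X" "x \<noteq> y"
    then have "w ` P x \<inter> w ` P y = {}" using disjoint_family_onD[OF U] im by simp
    then show "P x \<inter> P y = {}" by blast
  qed
  ultimately show ?thesis using assms by (subst card_bijs_images) auto
next
  case True
  show ?thesis unfolding True by simp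
qed

subsection \<open>Orderings of the vertices and their offset cycles\<close>

locale offset_setup =
  fixes k l q :: nat
  assumes l1: "1 \<le> l" and lk: "2 * l \<le> k" and q2: "2 \<le> q"
begin

abbreviation "n \<equiv> k * q"
abbreviation "m \<equiv> 2 * int q"

text \<open>The position ranges of the blocks, made periodic so that they form a block
  cycle.\<close>

definition pos :: "int \<Rightarrow> nat set" where
  "pos i = {block_start k l (nat (i mod m))..<block_start k l (Suc (nat (i mod m)))}"

definition bsize :: "int \<Rightarrow> nat" where
  "bsize i = (if even i then l else k - l)"

definition vertex_block :: "(nat \<Rightarrow> nat) \<Rightarrow> int \<Rightarrow> nat set" where
  "vertex_block w i = w ` pos i"

definition cycle_edges :: "(nat \<Rightarrow> nat) \<Rightarrow> nat set set" where
  "cycle_edges w = range (edge (vertex_block w))"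

definition orderings :: "(nat \<Rightarrow> nat) set" where
  "orderings = bijs {..<n} {1..n}"

lemma m_ge_4: "m \<ge> 4" using q2 by simp

lemma card_pos: "card (pos i) = bsize i"
proof -
  have "even (nat (i mod m)) \<longleftrightarrow> even i"
    using m_ge_4 by (simp add: even_nat_iff dvd_mod_iff)
  then show ?thesis using lk by (simp add: pos_def block_start_Suc bsize_def)
qed

lemma nat_mod_less: "nat (i mod m) < 2 * q"
  using m_ge_4 pos_mod_bound[of m i] by (simp add: nat_less_iff)

lemma pos_subset: "pos i \<subseteq> {..<n}"
proof -
  have "block_start k l (Suc (nat (i mod m))) \<le> block_start k l (2 * q)"
    using nat_mod_less lk by (intro block_start_mono) (auto simp: Suc_le_eq)
  also have "\<dots> = n" by (simp add: block_start_def)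
  finally show ?thesis by (auto simp: pos_def)
qed

lemma block_cycle_pos: "block_cycle m pos"
  unfolding block_cycle_def
proof (intro conjI allI impI)
  fix i j
  have "card (pos i) > 0" using l1 lk by (auto simp: card_pos bsize_def)
  then show "pos i \<noteq> {}" by auto
  show "pos i = pos j" if "m dvd i - j"
    using that by (simp add: pos_def mod_eq_dvd_iff[symmetric])
  assume "pos i \<inter> pos j \<noteq> {}"
  then obtain x where x: "x \<in> pos i" "x \<in> pos j" by blast
  have "\<not> nat (i mod m) < nat (j mod m)" "\<not> nat (j mod m) < nat (i mod m)"
    using x block_start_mono[of l k "Suc (nat (i mod m))" "nat (j mod m)"]
      block_start_mono[of l k "Suc (nat (j mod m))" "nat (i mod m)"] lk
    by (auto simp: pos_def Suc_le_eq)
  then have "nat (i mod m) = nat (j mod m)" using linorder_less_linear by blast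
  then have "i mod m = j mod m"
    using m_ge_4 pos_mod_sign[of m i] pos_mod_sign[of m j] by linarith
  then show "m dvd i - j" by (simp add: mod_eq_dvd_iff)
qed

lemma orderingsD:
  assumes "w \<in> orderings"
  shows "inj_on w {..<n}" "w ` {..<n} = {1..n}"
  using assms by (auto simp: orderings_def bijs_def bij_betw_def)

lemma block_cycle_vertex_block:
  assumes "w \<in> orderings"
  shows "block_cycle m (vertex_block w)"
  unfolding block_cycle_def
proof (intro conjI allI impI)
  fix i j
  show "vertex_block w i \<noteq> {}" using block_cycleD(1)[OF block_cycle_pos] by (simp add: vertex_block_def)
  show "vertex_block w i = vertex_block w j" if "m dvd i - j"
    using block_cycleD(2)[OF block_cycle_pos that] by (simp add: vertex_block_def)
  assume "vertex_block w i \<inter> vertex_block w j \<noteq> {}"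
  then have "w ` (pos i \<inter> pos j) \<noteq> {}"
    unfolding vertex_block_def using inj_on_image_Int[OF orderingsD(1)[OF assms] pos_subset pos_subset] by simp
  then show "m dvd i - j" using block_cycleD(3)[OF block_cycle_pos] by blast
qed

lemma card_vertex_block: "w \<in> orderings \<Longrightarrow> card (vertex_block w i) = bsize i"
  using card_image[OF inj_on_subset[OF orderingsD(1) pos_subset]] by (simp add: vertex_block_def card_pos)

lemma finite_vertex_block: "finite (vertex_block w i)"
  by (simp add: vertex_block_def pos_def)

lemma finite_orderings: "finite orderings" and card_orderings: "card orderings = fact n"
  by (simp_all add: orderings_def finite_bijs card_bijs)

lemma card_edge:
  assumes "w \<in> orderings"
  shows "card (edge (vertex_block w) i) = k"
proof -
  have "vertex_block w i \<inter> vertex_block w (i + 1) = {}"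
    using edge_Int(2)[OF block_cycle_vertex_block[OF assms] m_ge_4, of i] by (auto simp: edge_def)
  then have "card (edge (vertex_block w) i) = bsize i + bsize (i + 1)"
    unfolding edge_def by (subst card_Un_disjoint) (auto simp: finite_vertex_block card_vertex_block assms)
  then show ?thesis using lk by (auto simp: bsize_def)
qed

lemma cycle_edges_complete:
  assumes "w \<in> orderings"
  shows "cycle_edges w \<subseteq> complete_edges k n"
  unfolding complete_edges_def cycle_edges_def
proof clarify
  fix i
  have "vertex_block w j \<subseteq> {1..n}" for j
    using pos_subset orderingsD(2)[OF assms] unfolding vertex_block_def by blast
  then show "edge (vertex_block w) i \<subseteq> {1..n} \<and> card (edge (vertex_block w) i) = k"
    using card_edge[OF assms] by (auto simp: edge_def)
qed

lemma inj_on_edge: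
  assumes "w \<in> orderings"
  shows "inj_on (edge (vertex_block w)) {0..<m}"
proof (rule inj_onI)
  fix i j assume "i \<in> {0..<m}" "j \<in> {0..<m}" "edge (vertex_block w) i = edge (vertex_block w) j"
  then have "m dvd i - j"
    using edge_eq_iff[OF block_cycle_vertex_block[OF assms] m_ge_4] by blast
  then have "i mod m = j mod m" by (rule mod_eq_dvd_iff[THEN iffD2])
  then show "i = j" using \<open>i \<in> _\<close> \<open>j \<in> _\<close> by simp
qed

lemma cycle_edges_image:
  assumes "w \<in> orderings"
  shows "cycle_edges w = edge (vertex_block w) ` {0..<m}"
proof -
  have "edge (vertex_block w) i = edge (vertex_block w) (i mod m)" for i
    by (rule edge_cong[OF block_cycle_vertex_block[OF assms]]) (simp add: minus_mod_eq_mult_div)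
  moreover have "i mod m \<in> {0..<m}" for i using m_ge_4 by simp
  ultimately show ?thesis unfolding cycle_edges_def by blast
qed

lemma card_cycle_edges: "w \<in> orderings \<Longrightarrow> card (cycle_edges w) = 2 * q"
  by (simp add: cycle_edges_image card_image inj_on_edge)

lemma vertex_block_offset_block:
  assumes "i < 2 * q"
  shows "vertex_block w (int i) = offset_block k l w i"
  using assms by (simp add: vertex_block_def pos_def offset_block_def)

lemma cycle_edges_offset:
  assumes "w \<in> orderings"
  shows "cycle_edges w = (\<lambda>i. offset_block k l w i \<union> offset_block k l w (Suc i mod (2 * q))) ` {..<2 * q}"
proof -
  have *: "edge (vertex_block w) (int i) = offset_block k l w i \<union> offset_block k l w (Suc i mod (2 * q))"
    if "i < 2 * q" for i
  proof -
    have "vertex_block w (int i + 1) = vertex_block w (int (Suc i mod (2 * q)))"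
      by (rule block_cycleD(2)[OF block_cycle_vertex_block[OF assms]])
        (simp add: zmod_int minus_mod_eq_mult_div add.commute)
    then show ?thesis
      using that q2 by (simp add: edge_def vertex_block_offset_block)
  qed
  have "{0..<m} = int ` {..<2 * q}"
    using image_int_atLeastLessThan[of 0 "2 * q"] by (simp add: lessThan_atLeast0)
  then show ?thesis using * by (simp add: cycle_edges_image[OF assms] image_image)
qed

lemma offset_hamiltonian_iff:
  "offset_hamiltonian k l {1..n} H \<longleftrightarrow> (\<exists>w\<in>orderings. cycle_edges w \<subseteq> H)"
proof -
  have k: "k > 0" using l1 lk by simp
  have cardV: "card {1..n} = n" by simp
  have M: "2 * n div k = 2 * q" using k by simp
  let ?C = "\<lambda>v. (\<lambda>i. offset_block k l v i \<union> offset_block k l v (Suc i mod (2 * q))) ` {..<2 * q}"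
  have "offset_hamiltonian k l {1..n} H \<longleftrightarrow> (\<exists>v. bij_betw v {..<n} {1..n} \<and> ?C v \<subseteq> H)"
    unfolding offset_hamiltonian_def offset_hamilton_cycle_def cardV M Let_def by auto
  also have "\<dots> \<longleftrightarrow> (\<exists>w\<in>orderings. cycle_edges w \<subseteq> H)"
  proof
    assume "\<exists>v. bij_betw v {..<n} {1..n} \<and> ?C v \<subseteq> H"
    then obtain v where v: "bij_betw v {..<n} {1..n}" "?C v \<subseteq> H" by blast
    \<comment> \<open>Orderings are extensional; restricting \<open>v\<close> keeps all blocks, as
      they only use positions below \<open>n\<close>.\<close>
    let ?w = "restrict v {..<n}"
    have w: "?w \<in> orderings" using v by (simp add: orderings_def bijs_def)
    have "offset_block k l ?w i = offset_block k l v i" if "i < 2 * q" for i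
      using pos_subset[of "int i"] that unfolding offset_block_def
      by (intro image_cong) (auto simp: pos_def)
    then have "?C ?w = ?C v" using q2 by (intro image_cong) auto
    then have "cycle_edges ?w \<subseteq> H" using v(2) unfolding cycle_edges_offset[OF w] by (simp only:)
    then show "\<exists>w\<in>orderings. cycle_edges w \<subseteq> H" using w by blast
  next
    assume "\<exists>w\<in>orderings. cycle_edges w \<subseteq> H"
    then obtain w where w: "w \<in> orderings" "cycle_edges w \<subseteq> H" by blast
    have "bij_betw w {..<n} {1..n}" using w(1) by (simp add: orderings_def bijs_def)
    then show "\<exists>v. bij_betw v {..<n} {1..n} \<and> ?C v \<subseteq> H"
      using w(2) unfolding cycle_edges_offset[OF w(1)] by blast
  qed
  finally show ?thesis .
qed

section \<open>Orderings whose cycle contains given arcs\<close>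

definition arc_vertices :: "int \<times> nat \<Rightarrow> nat" where
  "arc_vertices = (\<lambda>(s, b). \<Sum>j\<le>b. bsize (s + int j))"

text \<open>A path of two or more edges determines all its blocks, a single edge does not determine
  its two blocks.\<close>

definition arc_orders :: "int \<times> nat \<Rightarrow> nat" where
  "arc_orders = (\<lambda>(s, b). if b = 1 then fact k else \<Prod>j\<le>b. fact (bsize (s + int j)))"

definition containing :: "(nat \<Rightarrow> nat) \<Rightarrow> (int \<times> nat) set \<Rightarrow> (nat \<Rightarrow> nat) set" where
  "containing v A = {w \<in> orderings. \<forall>(s, b)\<in>A. \<forall>i<b. edge (vertex_block v) (s + int i) \<in> cycle_edges w}"

text \<open>Union bound over placements: by \<open>arc_placement\<close> each arc has
  \<open>m\<close> starts and two directions, hence 4q placements, and a fixed choice says which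
  positions carry the disjoint vertex sets of the arcs.\<close>

lemma card_containing_le:
  assumes v: "v \<in> orderings" and A: "finite A" "\<And>s b. (s, b) \<in> A \<Longrightarrow> 1 \<le> b"
    and sep: "inj_on (\<lambda>((s, b), i). (s + int i) mod m) (Sigma A (\<lambda>(s, b). {..b}))"
  shows "card (containing v A) \<le>
    (4 * q) ^ card A * ((\<Prod>a\<in>A. arc_orders a) * fact (n - (\<Sum>a\<in>A. arc_vertices a)))"
proof -
  \<comment> \<open>\<open>J\<close> indexes the prescribed sets of an arc: the whole edge if there
    is just one, its \<open>b + 1\<close> blocks otherwise. \<open>U\<close> gives these vertex
    sets, \<open>P\<close> the positions that the choice of placements \<open>\<phi>\<close> assigns
    to them.\<close>
  define J where "J = (\<lambda>(s :: int, b :: nat). if b = 1 then {0} else {..b})"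
  define U where "U = (\<lambda>((s :: int, b :: nat), j :: nat). if b = 1 then edge (vertex_block v) s else vertex_block v (s + int j))"
  define P where "P = (\<lambda>\<phi> ((s :: int, b :: nat), j :: nat). case \<phi> (s, b) of (t, d) \<Rightarrow>
      if b = 1 then edge pos t else pos (block_place t d j))"
  define X where "X = Sigma A J"
  define \<Phi> where "\<Phi> = A \<rightarrow>\<^sub>E {0..<m} \<times> {1, -1 :: int}"
  have finX: "finite X" unfolding X_def J_def using A(1) by auto
  have edge_image: "edge (vertex_block w) t = w ` edge pos t" for w t
    by (auto simp: edge_def vertex_block_def)
  have sub: "containing v A \<subseteq> (\<Union>\<phi>\<in>\<Phi>. {w \<in> orderings. \<forall>x\<in>X. w ` P \<phi> x = U x})"
  proof
    fix w assume w: "w \<in> containing v A"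
    then have wW: "w \<in> orderings" by (simp add: containing_def)
    have "\<exists>td \<in> {0..<m} \<times> {1, -1 :: int}. \<forall>i<snd a.
        edge (vertex_block v) (fst a + int i) = edge (vertex_block w) (fst td + snd td * int i)" if "a \<in> A" for a
    proof -
      have "\<forall>i<snd a. edge (vertex_block v) (fst a + int i) \<in> range (edge (vertex_block w))"
        using w that by (auto simp: containing_def cycle_edges_def)
      then have "\<exists>t\<in>{0..<m}. \<exists>d\<in>{1, -1}. \<forall>i<snd a.
          edge (vertex_block v) (fst a + int i) = edge (vertex_block w) (t + d * int i)"
        by (rule arc_placement[OF block_cycle_vertex_block[OF v] block_cycle_vertex_block[OF wW] m_ge_4])
      then obtain t d where "t \<in> {0..<m}" "d \<in> {1, -1}"
        "\<forall>i<snd a. edge (vertex_block v) (fst a + int i) = edge (vertex_block w) (t + d * int i)" by blast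
      then show ?thesis by (intro bexI[of _ "(t, d)"]) simp_all
    qed
    then have "\<forall>a\<in>A. \<exists>td. td \<in> {0..<m} \<times> {1, -1 :: int} \<and> (\<forall>i<snd a.
        edge (vertex_block v) (fst a + int i) = edge (vertex_block w) (fst td + snd td * int i))" by blast
    from bchoice[OF this] obtain \<phi> where \<phi>: "\<And>a. a \<in> A \<Longrightarrow> \<phi> a \<in> {0..<m} \<times> {1, -1 :: int}"
      "\<And>a i. a \<in> A \<Longrightarrow> i < snd a \<Longrightarrow>
        edge (vertex_block v) (fst a + int i) = edge (vertex_block w) (fst (\<phi> a) + snd (\<phi> a) * int i)"
      by blast
    define \<psi> where "\<psi> = restrict \<phi> A"
    have "\<psi> \<in> \<Phi>" using \<phi>(1) unfolding \<psi>_def \<Phi>_def restrict_PiE_iff by blast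
    moreover have "w ` P \<psi> x = U x" if "x \<in> X" for x
    proof -
      obtain s b j where x: "x = ((s, b), j)" by (metis prod.collapse)
      have a: "(s, b) \<in> A" and j: "j \<in> J (s, b)" using that by (auto simp: x X_def)
      obtain t d where td: "\<phi> (s, b) = (t, d)" by fastforce
      have d: "d \<in> {1, -1}" using \<phi>(1)[OF a] td by auto
      have eq: "\<forall>i<b. edge (vertex_block v) (s + int i) = edge (vertex_block w) (t + d * int i)"
        using \<phi>(2)[OF a] td by auto
      show ?thesis
      proof (cases "b = 1")
        case True
        then show ?thesis using eq[rule_format, of 0] a td edge_image
          by (simp add: x U_def P_def \<psi>_def)
      next
        case False
        then have "2 \<le> b" "j \<le> b" using A(2)[OF a] j by (auto simp: J_def)
        then have "vertex_block v (s + int j) = vertex_block w (block_place t d j)"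
          using arc_blocks[OF block_cycle_vertex_block[OF v] block_cycle_vertex_block[OF wW] m_ge_4 d _ eq] by blast
        then show ?thesis using False a td by (simp add: x U_def P_def \<psi>_def vertex_block_def)
      qed
    qed
    ultimately show "w \<in> (\<Union>\<phi>\<in>\<Phi>. {w \<in> orderings. \<forall>x\<in>X. w ` P \<phi> x = U x})" using wW by blast
  qed
  have vertex_block_disj: "vertex_block v (s + int i) \<inter> vertex_block v (s' + int i') = {}"
    if "(s, b) \<in> A" "(s', b') \<in> A" "i \<le> b" "i' \<le> b'" "((s, b), i) \<noteq> ((s', b'), i')" for s b i s' b' i'
  proof (rule ccontr)
    assume "vertex_block v (s + int i) \<inter> vertex_block v (s' + int i') \<noteq> {}"
    then have "(s + int i) mod m = (s' + int i') mod m"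
      using block_cycleD(3)[OF block_cycle_vertex_block[OF v]] by (simp add: mod_eq_dvd_iff)
    then show False using inj_onD[OF sep, of "((s, b), i)" "((s', b'), i')"] that by auto
  qed
  \<comment> \<open>Single edges and blocks are treated alike by enclosing each in the blocks of its
    arc; disjointness for different arcs then follows from \<open>sep\<close>.\<close>
  have U_sub: "U ((s, b), j) \<subseteq> (\<Union>i\<in>{..b}. vertex_block v (s + int i))" if "j \<in> J (s, b)" for s b j
  proof (cases "b = 1")
    case True
    have "edge (vertex_block v) s = vertex_block v (s + int 0) \<union> vertex_block v (s + int 1)" by (simp add: edge_def)
    then show ?thesis using True by (auto simp: U_def)
  next
    case False
    then show ?thesis using that by (auto simp: U_def J_def)
  qed
  have U_disj: "disjoint_family_on U X"
    unfolding disjoint_family_on_def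
  proof (intro ballI impI)
    fix x y assume xX: "x \<in> X" and yX: "y \<in> X" and ne: "x \<noteq> y"
    obtain s b j where x: "x = ((s, b), j)" by (metis prod.collapse)
    obtain s' b' j' where y: "y = ((s', b'), j')" by (metis prod.collapse)
    have a: "(s, b) \<in> A" "j \<in> J (s, b)" "(s', b') \<in> A" "j' \<in> J (s', b')"
      using xX yX by (auto simp: x y X_def)
    show "U x \<inter> U y = {}"
    proof (cases "(s, b) = (s', b')")
      case True
      then have b: "b \<noteq> 1" "b' = b" "s' = s" "j \<noteq> j'"
        using a(2,4) ne by (auto simp: x y J_def split: if_splits)
      then have "j \<le> b" "j' \<le> b'" using a(2,4) by (auto simp: J_def)
      then have "vertex_block v (s + int j) \<inter> vertex_block v (s' + int j') = {}"
        using b(4) by (intro vertex_block_disj[OF a(1,3)]) simp_all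
      then show ?thesis using b by (simp add: x y U_def)
    next
      case False
      then have "(\<Union>i\<in>{..b}. vertex_block v (s + int i)) \<inter> (\<Union>i\<in>{..b'}. vertex_block v (s' + int i)) = {}"
        using vertex_block_disj[OF a(1,3)] by fastforce
      with Int_mono[OF U_sub[OF a(2)] U_sub[OF a(4)]] show ?thesis
        unfolding x y by (simp only: subset_empty)
    qed
  qed
  have bs2: "bsize s + bsize (s + 1) = k" for s using lk by (auto simp: bsize_def)
  have cU: "(\<Sum>j\<in>J a. card (U (a, j))) = arc_vertices a"
    "(\<Prod>j\<in>J a. fact (card (U (a, j))) :: nat) = arc_orders a" for a
  proof -
    obtain s b where a: "a = (s, b)" by fastforce
    show "(\<Sum>j\<in>J a. card (U (a, j))) = arc_vertices a"
      "(\<Prod>j\<in>J a. fact (card (U (a, j))) :: nat) = arc_orders a"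
      using bs2[of s]
      by (simp_all add: a J_def U_def arc_vertices_def arc_orders_def card_edge[OF v] card_vertex_block[OF v])
  qed
  have finJ: "\<forall>a\<in>A. finite (J a)" by (auto simp: J_def)
  have each: "card {w \<in> orderings. \<forall>x\<in>X. w ` P \<phi> x = U x} \<le>
      (\<Prod>a\<in>A. arc_orders a) * fact (n - (\<Sum>a\<in>A. arc_vertices a))" for \<phi>
  proof -
    have "P \<phi> x \<subseteq> {..<n}" for x
      using pos_subset by (auto simp: P_def edge_def split: prod.splits if_splits)
    then have "card {w \<in> orderings. \<forall>x\<in>X. w ` P \<phi> x = U x} \<le>
        (\<Prod>x\<in>X. fact (card (U x))) * fact (card {1..n} - (\<Sum>x\<in>X. card (U x)))"
      unfolding orderings_def using finX U_disj by (intro card_bijs_images_le) auto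
    also have "(\<Sum>x\<in>X. card (U x)) = (\<Sum>a\<in>A. \<Sum>j\<in>J a. card (U (a, j)))"
      unfolding X_def using A(1) finJ by (subst sum.Sigma) (auto simp: split_def)
    also have "(\<Prod>x\<in>X. fact (card (U x)) :: nat) = (\<Prod>a\<in>A. \<Prod>j\<in>J a. fact (card (U (a, j))))"
      unfolding X_def using A(1) finJ by (subst prod.Sigma) (auto simp: split_def)
    finally show ?thesis by (simp add: cU)
  qed
  have fin\<Phi>: "finite \<Phi>" unfolding \<Phi>_def using A(1) by (intro finite_PiE) auto
  have "card (containing v A) \<le> card (\<Union>\<phi>\<in>\<Phi>. {w \<in> orderings. \<forall>x\<in>X. w ` P \<phi> x = U x})"
    by (rule card_mono[OF _ sub]) (use fin\<Phi> finite_orderings in simp)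
  also have "\<dots> \<le> (\<Sum>\<phi>\<in>\<Phi>. card {w \<in> orderings. \<forall>x\<in>X. w ` P \<phi> x = U x})"
    by (rule card_UN_le[OF fin\<Phi>])
  also have "\<dots> \<le> (\<Sum>\<phi>\<in>\<Phi>. (\<Prod>a\<in>A. arc_orders a) * fact (n - (\<Sum>a\<in>A. arc_vertices a)))"
    by (intro sum_mono each)
  also have "\<dots> = card \<Phi> * ((\<Prod>a\<in>A. arc_orders a) * fact (n - (\<Sum>a\<in>A. arc_vertices a)))"
    by simp
  also have "card \<Phi> = (4 * q) ^ card A"
    unfolding \<Phi>_def using A(1) by (simp add: card_PiE card_cartesian_product nat_mult_distrib)
  finally show ?thesis .
qed

subsection \<open>Counting pairs of cycles by their common edges\<close>

text \<open>The base in \<open>fact_falling_lower\<close>: every vertex with a prescribed place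
  saves a factor \<eta>.\<close>

definition \<eta> :: real where "\<eta> = real n / exp 1"
definition L :: real where "L = fact l * fact (k - l)"
definition block_cost :: "int \<Rightarrow> real" where "block_cost i = fact (bsize i) / \<eta> ^ bsize i"
text \<open>4q counts the placements. One factor k! covers the inner orders of a single edge; the
  other one, together with \<eta>^l, covers the two end blocks.\<close>

definition arc_cost :: "real \<Rightarrow> nat \<Rightarrow> real" where
  "arc_cost \<rho> b = 4 * real q * ((fact k)\<^sup>2 / \<eta> ^ l) * \<rho> ^ b"

lemma eta_ge_1: "\<eta> \<ge> 1"
proof -
  have "4 \<le> k * q" using l1 lk q2 mult_mono[of 2 k 2 q] by simp
  then have "4 \<le> real n" by (simp only: of_nat_mult[symmetric])
  then have "exp 1 \<le> real n" using exp_le by linarith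
  then show ?thesis by (simp add: \<eta>_def)
qed

lemma L_pos: "L > 0" by (simp add: L_def)

lemma arc_cost_nonneg: "\<rho> \<ge> 0 \<Longrightarrow> arc_cost \<rho> b \<ge> 0"
  using eta_ge_1 by (simp add: arc_cost_def)

lemma block_cost_pos: "block_cost i > 0" using eta_ge_1 by (simp add: block_cost_def)

lemma block_cost_mult: "block_cost i * block_cost (i + 1) = L / \<eta> ^ k"
proof -
  have "\<eta> ^ l * \<eta> ^ (k - l) = \<eta> ^ k" using lk by (simp add: power_add[symmetric])
  then show ?thesis by (auto simp: block_cost_def bsize_def L_def mult.commute)
qed

lemma block_cost_le: "block_cost i \<le> fact k / \<eta> ^ l"
proof -
  have "bsize i \<le> k" "l \<le> bsize i" using lk by (auto simp: bsize_def)
  then show ?thesis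
    unfolding block_cost_def using eta_ge_1 by (intro frac_le fact_mono power_increasing) auto
qed

text \<open>Each inner block lies in two neighbouring pairs, each end block in one. So the square is
  the product over the \<open>b\<close> pairs, each worth \<open>L / \<eta> ^ k\<close>, times one
  further copy of both end blocks.\<close>

lemma prod_block_cost_square: "(\<Prod>j\<le>b. block_cost (s + int j))\<^sup>2 = (L / \<eta> ^ k) ^ b * (block_cost s * block_cost (s + int b))"
proof (induction b)
  case (Suc b)
  have "(\<Prod>j\<le>Suc b. block_cost (s + int j))\<^sup>2 = (\<Prod>j\<le>b. block_cost (s + int j))\<^sup>2 * (block_cost (s + int (Suc b)))\<^sup>2"
    by (simp add: power_mult_distrib)
  also have "\<dots> = (L / \<eta> ^ k) ^ b * (block_cost (s + int b) * block_cost (s + int b + 1)) * (block_cost s * block_cost (s + int (Suc b)))"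
    unfolding Suc.IH by (simp add: power2_eq_square add.assoc add.commute[of 1])
  also have "\<dots> = (L / \<eta> ^ k) ^ Suc b * (block_cost s * block_cost (s + int (Suc b)))"
    unfolding block_cost_mult by simp
  finally show ?case .
qed (simp add: power2_eq_square)

text \<open>Comparing squares removes the root and any dependence on parity: the powers of
  \<open>L / \<eta> ^ k\<close> cancel and the end blocks remain, each costing at most k! / \<eta>^l
  because its size lies between \<open>l\<close> and \<open>k\<close>.\<close>

lemma prod_block_cost_le:
  assumes "\<rho> \<ge> 0"
  shows "(\<rho> * sqrt (\<eta> ^ k / L)) ^ b * (\<Prod>j\<le>b. block_cost (s + int j)) \<le> \<rho> ^ b * (fact k / \<eta> ^ l)"
proof (rule power2_le_imp_le)
  have pos: "\<eta> ^ k / L > 0" using eta_ge_1 L_pos by simp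
  have sq: "((\<rho> * sqrt (\<eta> ^ k / L)) ^ b)\<^sup>2 = (\<rho> ^ b)\<^sup>2 * (\<eta> ^ k / L) ^ b"
    using pos by (simp add: power_mult_distrib power_mult[symmetric] mult.commute[of b 2] real_sqrt_pow2
        del: real_sqrt_divide) (simp add: power_mult)
  have "((\<rho> * sqrt (\<eta> ^ k / L)) ^ b * (\<Prod>j\<le>b. block_cost (s + int j)))\<^sup>2 =
      (\<rho> ^ b)\<^sup>2 * ((\<eta> ^ k / L) ^ b * (L / \<eta> ^ k) ^ b) * (block_cost s * block_cost (s + int b))"
    by (subst power_mult_distrib, subst sq, subst prod_block_cost_square) (simp only: mult.assoc)
  also have "(\<eta> ^ k / L) ^ b * (L / \<eta> ^ k) ^ b = 1"
    using pos eta_ge_1 L_pos by (simp add: power_mult_distrib[symmetric])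
  also have "(\<rho> ^ b)\<^sup>2 * 1 * (block_cost s * block_cost (s + int b)) \<le> (\<rho> ^ b)\<^sup>2 * 1 * ((fact k / \<eta> ^ l) * (fact k / \<eta> ^ l))"
    using eta_ge_1 block_cost_pos by (intro mult_left_mono mult_mono block_cost_le) (auto intro: less_imp_le)
  also have "\<dots> = (\<rho> ^ b * (fact k / \<eta> ^ l))\<^sup>2"
    by (simp add: power2_eq_square mult_ac)
  finally show "((\<rho> * sqrt (\<eta> ^ k / L)) ^ b * (\<Prod>j\<le>b. block_cost (s + int j)))\<^sup>2 \<le> (\<rho> ^ b * (fact k / \<eta> ^ l))\<^sup>2" .
  show "0 \<le> \<rho> ^ b * (fact k / \<eta> ^ l)" using assms eta_ge_1 by simp
qed

text \<open>The factor k! is there for single edges: their k! orders are set against a product of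
  factorials that is at least 1.\<close>

lemma arc_orders_le:
  "real (arc_orders (s, b)) / \<eta> ^ arc_vertices (s, b) \<le> fact k * (\<Prod>j\<le>b. block_cost (s + int j))"
proof -
  have "real (arc_orders (s, b)) \<le> fact k * (\<Prod>j\<le>b. fact (bsize (s + int j)))"
  proof (cases "b = 1")
    case True
    have "(1::real) \<le> (\<Prod>j\<le>b. fact (bsize (s + int j)))" by (intro prod_ge_1) auto
    then show ?thesis using True by (simp add: arc_orders_def)
  next
    case False
    have "1 * (\<Prod>j\<le>b. fact (bsize (s + int j)) :: real) \<le> fact k * (\<Prod>j\<le>b. fact (bsize (s + int j)))"
      by (intro mult_right_mono prod_nonneg) auto
    then show ?thesis using False by (simp add: arc_orders_def)
  qed
  then have "real (arc_orders (s, b)) / \<eta> ^ arc_vertices (s, b) \<le>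
      fact k * (\<Prod>j\<le>b. fact (bsize (s + int j))) / \<eta> ^ arc_vertices (s, b)"
    using eta_ge_1 by (intro divide_right_mono) auto
  also have "\<dots> = fact k * (\<Prod>j\<le>b. block_cost (s + int j))"
    by (simp add: block_cost_def arc_vertices_def prod_dividef power_sum)
  finally show ?thesis .
qed

lemma sum_bsize: "(\<Sum>i\<in>{0..<m}. bsize i) = n"
proof -
  have "(\<Sum>i<2 * r. bsize (int i)) = k * r" for r
    using lk by (induction r) (auto simp: bsize_def)
  moreover have "{0..<m} = int ` {..<2 * q}"
    using image_int_atLeastLessThan[of 0 "2 * q"] by (simp add: lessThan_atLeast0)
  ultimately show ?thesis by (simp add: sum.reindex)
qed

lemma bsize_mod: "bsize (i mod m) = bsize i"
  by (simp add: bsize_def dvd_mod_iff)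

text \<open>By \<open>sep\<close> the arcs use each block at most once. Hence subtracting their
  vertices from \<open>n\<close> is never truncated.\<close>

lemma sum_arc_vertices_le:
  assumes A: "finite A"
    and sep: "inj_on (\<lambda>((s, b), i). (s + int i) mod m) (Sigma A (\<lambda>(s, b). {..b}))"
  shows "(\<Sum>a\<in>A. arc_vertices a) \<le> n"
proof -
  let ?D = "Sigma A (\<lambda>(s, b). {..b})" and ?f = "\<lambda>((s, b), i). (s + int i) mod m"
  have "(\<Sum>a\<in>A. arc_vertices a) = (\<Sum>a\<in>A. \<Sum>j\<in>(\<lambda>(s, b). {..b}) a. bsize (fst a + int j))"
    by (intro sum.cong) (auto simp: arc_vertices_def)
  also have "\<dots> = (\<Sum>x\<in>?D. bsize (fst (fst x) + int (snd x)))"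
    using A by (subst sum.Sigma) (auto simp: split_def)
  also have "\<dots> = (\<Sum>x\<in>?D. bsize (?f x))"
    by (intro sum.cong) (auto simp: bsize_mod)
  also have "\<dots> = (\<Sum>y\<in>?f ` ?D. bsize y)" using sum.reindex[OF sep, of bsize] by simp
  also have "\<dots> \<le> (\<Sum>y\<in>{0..<m}. bsize y)"
    using m_ge_4 by (intro sum_mono2) auto
  finally show ?thesis by (simp add: sum_bsize)
qed

text \<open>Here \<open>z\<close> stands for 1/p. The weight, the placements, the orders and the
  power of \<eta> gained from the falling factorial all factor over the arcs, so each arc is bounded
  by itself.\<close>

lemma containing_cost_le:
  assumes v: "v \<in> orderings" and A: "finite A" "\<And>s b. (s, b) \<in> A \<Longrightarrow> 1 \<le> b"
    and sep: "inj_on (\<lambda>((s, b), i). (s + int i) mod m) (Sigma A (\<lambda>(s, b). {..b}))"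
    and \<rho>: "\<rho> \<ge> 0" and z: "z = \<rho> * sqrt (\<eta> ^ k / L)"
  shows "z ^ (\<Sum>(s, b)\<in>A. b) * real (card (containing v A)) \<le> fact n * (\<Prod>(s, b)\<in>A. arc_cost \<rho> b)"
proof -
  let ?V = "\<Sum>a\<in>A. arc_vertices a"
  have z0: "z \<ge> 0" using \<rho> L_pos eta_ge_1 by (simp add: z)
  have V: "?V \<le> n" by (rule sum_arc_vertices_le[OF A(1) sep])
  have f: "fact (n - ?V) \<le> fact n / \<eta> ^ ?V"
  proof -
    have "\<eta> ^ ?V * fact (n - ?V) \<le> fact n"
      using fact_falling_lower[of "n - ?V" ?V] V by (simp only: le_add_diff_inverse2 \<eta>_def)
    then show ?thesis using eta_ge_1 by (simp add: pos_le_divide_eq mult.commute)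
  qed
  have "z ^ (\<Sum>(s, b)\<in>A. b) * real (card (containing v A)) \<le> z ^ (\<Sum>(s, b)\<in>A. b) *
      real ((4 * q) ^ card A * ((\<Prod>a\<in>A. arc_orders a) * fact (n - ?V)))"
    using card_containing_le[OF v A sep] z0
    by (intro mult_left_mono) (simp_all del: of_nat_mult of_nat_power add: of_nat_le_iff)
  also have "\<dots> = z ^ (\<Sum>(s, b)\<in>A. b) * ((4 * real q) ^ card A * ((\<Prod>a\<in>A. real (arc_orders a)) * fact (n - ?V)))"
    by simp
  also have "\<dots> \<le> z ^ (\<Sum>(s, b)\<in>A. b) * ((4 * real q) ^ card A * ((\<Prod>a\<in>A. real (arc_orders a)) * (fact n / \<eta> ^ ?V)))"
    using z0 f by (intro mult_left_mono prod_nonneg) auto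
  also have "\<dots> = fact n * (\<Prod>(s, b)\<in>A. 4 * real q * (z ^ b * (real (arc_orders (s, b)) / \<eta> ^ arc_vertices (s, b))))"
    by (simp add: split_def prod.distrib prod_dividef power_sum)
  also have "\<dots> \<le> fact n * (\<Prod>(s, b)\<in>A. arc_cost \<rho> b)"
  proof (intro mult_left_mono prod_mono)
    fix a assume "a \<in> A"
    obtain s b where a: "a = (s, b)" by fastforce
    have "z ^ b * (real (arc_orders (s, b)) / \<eta> ^ arc_vertices (s, b)) \<le>
        z ^ b * (fact k * (\<Prod>j\<le>b. block_cost (s + int j)))"
      using z0 by (intro mult_left_mono arc_orders_le) auto
    also have "\<dots> = fact k * (z ^ b * (\<Prod>j\<le>b. block_cost (s + int j)))" by simp
    also have "\<dots> \<le> fact k * (\<rho> ^ b * (fact k / \<eta> ^ l))"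
      unfolding z by (intro mult_left_mono prod_block_cost_le \<rho>) auto
    finally have "4 * real q * (z ^ b * (real (arc_orders (s, b)) / \<eta> ^ arc_vertices (s, b))) \<le>
        4 * real q * (fact k * (\<rho> ^ b * (fact k / \<eta> ^ l)))"
      by (intro mult_left_mono) auto
    also have "\<dots> = arc_cost \<rho> b" by (simp add: arc_cost_def power2_eq_square)
    finally show "0 \<le> (case a of (s, b) \<Rightarrow> 4 * real q * (z ^ b * (real (arc_orders (s, b)) / \<eta> ^ arc_vertices (s, b)))) \<and>
        (case a of (s, b) \<Rightarrow> 4 * real q * (z ^ b * (real (arc_orders (s, b)) / \<eta> ^ arc_vertices (s, b)))) \<le>
        (case a of (s, b) \<Rightarrow> arc_cost \<rho> b)"
      using z0 eta_ge_1 by (simp add: a)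
  qed auto
  finally show ?thesis .
qed

lemma sum_common_edges_le:
  assumes v: "v \<in> orderings" and \<rho>: "\<rho> \<ge> 0" and z: "z = \<rho> * sqrt (\<eta> ^ k / L)" and z1: "z \<ge> 1"
  shows "(\<Sum>w\<in>orderings. z ^ card (cycle_edges v \<inter> cycle_edges w)) \<le>
    fact n * (exp (2 * real q * (\<Sum>b\<in>{1..<2 * q}. arc_cost \<rho> b)) + z * arc_cost \<rho> (2 * q - 1))"
proof -
  let ?Z = "{0..<m}"
  let ?proper = "{S. S \<subseteq> ?Z \<and> S \<noteq> ?Z}"
  let ?D = "?Z \<times> {1..<2 * q}"
  define T where "T w = {i \<in> ?Z. edge (vertex_block v) i \<in> cycle_edges w}" for w
  define N where "N S = {w \<in> orderings. S \<subseteq> T w}" for S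
  define f where "f = (\<lambda>(s :: int, b). arc_cost \<rho> b)"
  have f0: "f a \<ge> 0" for a using arc_cost_nonneg[OF \<rho>] by (simp add: f_def split: prod.split)
  have cardT: "card (cycle_edges v \<inter> cycle_edges w) = card (T w)" for w
  proof -
    have "cycle_edges v \<inter> cycle_edges w = edge (vertex_block v) ` T w" by (auto simp: T_def cycle_edges_image[OF v])
    moreover have "inj_on (edge (vertex_block v)) (T w)"
      by (rule inj_on_subset[OF inj_on_edge[OF v]]) (auto simp: T_def)
    ultimately show ?thesis by (simp add: card_image)
  qed
  have Pow_eq: "Pow ?Z = insert ?Z ?proper" by auto
  have "(\<Sum>w\<in>orderings. z ^ card (cycle_edges v \<inter> cycle_edges w)) \<le> (\<Sum>w\<in>orderings. \<Sum>S\<in>Pow ?Z. if S \<subseteq> T w then z ^ card S else 0)"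
  proof (intro sum_mono)
    fix w
    \<comment> \<open>Only the term \<open>S = T w\<close> of the inner sum is kept.\<close>
    have "z ^ card (T w) = (if T w \<subseteq> T w then z ^ card (T w) else 0)" by simp
    also have "\<dots> \<le> (\<Sum>S\<in>Pow ?Z. if S \<subseteq> T w then z ^ card S else 0)"
      by (rule member_le_sum) (use z1 in \<open>auto simp: T_def\<close>)
    finally show "z ^ card (cycle_edges v \<inter> cycle_edges w) \<le> \<dots>" unfolding cardT .
  qed
  also have "\<dots> = (\<Sum>S\<in>Pow ?Z. \<Sum>w\<in>orderings. if S \<subseteq> T w then z ^ card S else 0)"
    by (rule sum.swap)
  also have "\<dots> = (\<Sum>S\<in>Pow ?Z. z ^ card S * real (card (N S)))"
    using finite_orderings by (simp add: N_def sum.If_cases Int_def mult.commute)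
  also have "\<dots> = z ^ card ?Z * real (card (N ?Z)) + (\<Sum>S\<in>?proper. z ^ card S * real (card (N S)))"
    unfolding Pow_eq by (subst sum.insert) (auto intro: finite_subset[of _ "Pow ?Z"])
  \<comment> \<open>The full set has no arcs. Every ordering counted for it also contains the arc of
    2q - 1 edges from 0; the edge left out costs a factor \<open>z\<close>.\<close>
  also have "z ^ card ?Z * real (card (N ?Z)) \<le> fact n * (z * arc_cost \<rho> (2 * q - 1))"
  proof -
    let ?A = "{(0 :: int, 2 * q - 1)}"
    have "N ?Z \<subseteq> containing v ?A"
      by (auto simp: N_def T_def containing_def subset_iff)
    then have "card (N ?Z) \<le> card (containing v ?A)"
      by (rule card_mono[rotated]) (simp add: containing_def finite_orderings)
    moreover have "card ?Z = Suc (2 * q - 1)" using q2 by (simp add: nat_mult_distrib)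
    ultimately have "z ^ card ?Z * real (card (N ?Z)) \<le> z * (z ^ (2 * q - 1) * real (card (containing v ?A)))"
      using z1 by (simp only: power_Suc mult.assoc) (intro mult_left_mono, auto)
    also have "z ^ (2 * q - 1) * real (card (containing v ?A)) \<le> fact n * arc_cost \<rho> (2 * q - 1)"
      using containing_cost_le[OF v, of ?A, OF _ _ _ \<rho> z] q2
      by (auto simp: inj_on_def mod_pos_pos_trivial)
    finally show ?thesis using z1 by (simp add: mult_left_mono mult.left_commute)
  qed
  also have "(\<Sum>S\<in>?proper. z ^ card S * real (card (N S))) \<le> (\<Sum>S\<in>?proper. fact n * (\<Prod>a\<in>arcs m S. f a))"
  proof (intro sum_mono)
    fix S assume "S \<in> ?proper"
    then have S: "S \<subseteq> ?Z" "S \<noteq> ?Z" by auto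
    have sub: "arcs m S \<subseteq> ?D"
    proof
      fix a assume a: "a \<in> arcs m S"
      obtain s b where "a = (s, b)" by fastforce
      then show "a \<in> ?D" using arcs_length[of s b m S] a S(1) by auto
    qed
    have fin: "finite (arcs m S)" by (rule finite_subset[OF sub]) simp
    have "N S \<subseteq> containing v (arcs m S)"
    proof
      fix w assume w: "w \<in> N S"
      have "edge (vertex_block v) (s + int i) \<in> cycle_edges w" if "(s, b) \<in> arcs m S" "i < b" for s b i
      proof -
        have "(s + int i) mod m \<in> S" using that by (auto simp: arcs_def)
        then have "edge (vertex_block v) ((s + int i) mod m) \<in> cycle_edges w"
          using w by (auto simp: N_def T_def)
        moreover have "edge (vertex_block v) ((s + int i) mod m) = edge (vertex_block v) (s + int i)"
          by (rule edge_cong[OF block_cycle_vertex_block[OF v]]) (simp add: mod_eq_dvd_iff[symmetric])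
        ultimately show ?thesis by simp
      qed
      then show "w \<in> containing v (arcs m S)" using w by (auto simp: N_def containing_def)
    qed
    then have c: "card (N S) \<le> card (containing v (arcs m S))"
      by (rule card_mono[rotated]) (simp add: containing_def finite_orderings)
    have "z ^ card S * real (card (N S)) \<le>
        z ^ (\<Sum>(s, b)\<in>arcs m S. b) * real (card (containing v (arcs m S)))"
      using z1 c card_le_sum_arcs[OF S fin] by (intro mult_mono power_increasing) auto
    also have "\<dots> \<le> fact n * (\<Prod>(s, b)\<in>arcs m S. arc_cost \<rho> b)"
      by (rule containing_cost_le[OF v fin _ arcs_separated[OF S(1)] \<rho> z])
        (use sub in auto)
    finally show "z ^ card S * real (card (N S)) \<le> fact n * (\<Prod>a\<in>arcs m S. f a)"
      by (simp add: f_def)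
  qed
  also have "\<dots> = fact n * (\<Sum>A\<in>arcs m ` ?proper. \<Prod>a\<in>A. f a)"
    using sum.reindex[OF inj_on_arcs, of "\<lambda>A. \<Prod>a\<in>A. f a" m] by (simp add: sum_distrib_left)
  \<comment> \<open>Admitting every set of pairs in \<open>?D\<close>, whether or not it is a set of
    arcs, turns the sum of products into a product of the terms \<open>f a + 1\<close>.\<close>
  also have "(\<Sum>A\<in>arcs m ` ?proper. \<Prod>a\<in>A. f a) \<le> (\<Sum>A\<in>Pow ?D. \<Prod>a\<in>A. f a)"
  proof (intro sum_mono2)
    show "arcs m ` ?proper \<subseteq> Pow ?D"
    proof
      fix X assume "X \<in> arcs m ` ?proper"
      then obtain S where X: "X = arcs m S" "S \<subseteq> ?Z" by blast
      have D: "(s, b) \<in> ?D" if "(s, b) \<in> X" for s b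
        using arcs_length[of s b m S] that X by auto
      show "X \<in> Pow ?D" by (intro PowI subrelI D)
    qed
  qed (auto intro!: prod_nonneg f0)
  also have "\<dots> = (\<Prod>a\<in>?D. f a + 1)"
    using prod_add[of ?D f "\<lambda>_. 1"] by simp
  also have "\<dots> \<le> (\<Prod>a\<in>?D. exp (f a))"
    using f0 by (intro prod_mono) (auto simp: add.commute intro!: exp_ge_add_one_self add_nonneg_nonneg)
  also have "\<dots> = exp (\<Sum>a\<in>?D. f a)" by (simp add: exp_sum)
  also have "(\<Sum>a\<in>?D. f a) = 2 * real q * (\<Sum>b\<in>{1..<2 * q}. arc_cost \<rho> b)"
    by (simp add: f_def sum.cartesian_product[symmetric] nat_mult_distrib)
  finally show ?thesis by (simp add: algebra_simps)
qed

lemma card_orderings_of_cycle_ge: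
  assumes w0: "w0 \<in> orderings"
  shows "fact l ^ q * fact (k - l) ^ q \<le> card {w \<in> orderings. cycle_edges w = cycle_edges w0}"
proof -
  let ?Y = "{w \<in> orderings. \<forall>i\<in>{0..<m}. w ` pos i = vertex_block w0 i}"
  have disj: "disjoint_family_on B {0..<m}" if "block_cycle m B" for B :: "int \<Rightarrow> nat set"
    unfolding disjoint_family_on_def
  proof (intro ballI impI, rule ccontr)
    fix i j assume ij: "i \<in> {0..<m}" "j \<in> {0..<m}" "i \<noteq> j" and "B i \<inter> B j \<noteq> {}"
    then have "i mod m = j mod m"
      using block_cycleD(3)[OF that] mod_eq_dvd_iff by blast
    then show False using ij by simp
  qed
  have "card ?Y = (\<Prod>i\<in>{0..<m}. fact (card (vertex_block w0 i))) * fact (card {1..n} - (\<Sum>i\<in>{0..<m}. card (vertex_block w0 i)))"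
    unfolding orderings_def
  proof (rule card_bijs_images)
    show "pos i \<subseteq> {..<n}" for i by (rule pos_subset)
    show "vertex_block w0 i \<subseteq> {1..n}" for i using pos_subset orderingsD(2)[OF w0] unfolding vertex_block_def by blast
    show "disjoint_family_on (vertex_block w0) {0..<m}" "disjoint_family_on pos {0..<m}"
      by (rule disj[OF block_cycle_vertex_block[OF w0]], rule disj[OF block_cycle_pos])
  qed (simp_all add: card_pos card_vertex_block w0)
  \<comment> \<open>The blocks exhaust all \<open>n\<close> vertices, so the last factorial is
    0!.\<close>
  also have "\<dots> = (\<Prod>i\<in>{0..<m}. fact (bsize i))"
    by (simp add: card_vertex_block w0 sum_bsize)
  also have "\<dots> = fact l ^ q * fact (k - l) ^ q"
  proof -
    have "(\<Prod>i<2 * r. fact (bsize (int i)) :: nat) = fact l ^ r * fact (k - l) ^ r" for r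
      using lk by (induction r) (auto simp: bsize_def)
    moreover have "{0..<m} = int ` {..<2 * q}"
      using image_int_atLeastLessThan[of 0 "2 * q"] by (simp add: lessThan_atLeast0)
    ultimately show ?thesis by (simp add: prod.reindex)
  qed
  finally have "card ?Y = fact l ^ q * fact (k - l) ^ q" .
  moreover have "?Y \<subseteq> {w \<in> orderings. cycle_edges w = cycle_edges w0}"
  proof clarify
    fix w assume w: "w \<in> orderings" and eq: "\<forall>i\<in>{0..<m}. w ` pos i = vertex_block w0 i"
    have per: "vertex_block w' (i mod m) = vertex_block w' i" if "w' \<in> orderings" for w' i
      by (rule block_cycleD(2)[OF block_cycle_vertex_block[OF that]]) (simp add: mod_eq_dvd_iff[symmetric])
    have "vertex_block w i = vertex_block w0 i" for i
    proof -
      have "i mod m \<in> {0..<m}" using m_ge_4 by simp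
      then have "vertex_block w (i mod m) = vertex_block w0 (i mod m)" using eq by (simp add: vertex_block_def)
      then show ?thesis by (simp only: per[OF w] per[OF w0])
    qed
    then have "vertex_block w = vertex_block w0" by blast
    then show "cycle_edges w = cycle_edges w0" by (simp add: cycle_edges_def)
  qed
  ultimately show ?thesis
    using card_mono[of "{w \<in> orderings. cycle_edges w = cycle_edges w0}" ?Y] finite_orderings by simp
qed

section \<open>Probability bounds for fixed \<open>n\<close>\<close>

lemma prob_hamiltonian_upper:
  assumes "0 \<le> p" "p \<le> 1"
  shows "measure_pmf.prob (random_hypergraph k n p) {H. offset_hamiltonian k l {1..n} H} \<le>
    fact n * p ^ (2 * q) / (fact l * fact (k - l)) ^ q"
  unfolding card_orderings[symmetric, THEN arg_cong[where f = real], unfolded of_nat_fact] offset_hamiltonian_iff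
proof (rule prob_first_moment[where C = cycle_edges])
  fix H assume "\<exists>w\<in>orderings. cycle_edges w \<subseteq> H"
  then obtain w0 where w0: "w0 \<in> orderings" "cycle_edges w0 \<subseteq> H" by blast
  have "{w \<in> orderings. cycle_edges w = cycle_edges w0} \<subseteq> {w \<in> orderings. cycle_edges w \<subseteq> H}" using w0 by auto
  then have "card {w \<in> orderings. cycle_edges w = cycle_edges w0} \<le> card {w \<in> orderings. cycle_edges w \<subseteq> H}"
    by (rule card_mono[rotated]) (simp add: finite_orderings)
  with card_orderings_of_cycle_ge[OF w0(1)]
  have "fact l ^ q * fact (k - l) ^ q \<le> card {w \<in> orderings. cycle_edges w \<subseteq> H}"
    by (rule order_trans)
  then have "real (fact l ^ q * fact (k - l) ^ q) \<le> real (card {w \<in> orderings. cycle_edges w \<subseteq> H})"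
    by (rule of_nat_mono)
  then show "(fact l * fact (k - l)) ^ q \<le> real (card {w \<in> orderings. cycle_edges w \<subseteq> H})"
    by (simp add: power_mult_distrib)
qed (use assms finite_orderings cycle_edges_complete card_cycle_edges in auto)

text \<open>The second moment method with \<delta> = exp X + Y - 1: X bounds the part of the proper
  subsets through a geometric series, Y the part of the full cycle. The separate bound
  \<open>r\<close> on \<rho> keeps the constants independent of \<open>q\<close>.\<close>

lemma prob_hamiltonian_lower:
  assumes p: "0 < p" "p \<le> 1" and \<rho>: "1 / p = \<rho> * sqrt (\<eta> ^ k / L)" "0 \<le> \<rho>" "\<rho> \<le> r" "r < 1"
  shows "measure_pmf.prob (random_hypergraph k n p) {H. offset_hamiltonian k l {1..n} H} \<ge>
    2 - exp (8 * (fact k)\<^sup>2 * exp 1 ^ l / (1 - r) * ((real q)\<^sup>2 / real q ^ l * \<rho>))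
      - 4 * (fact k)\<^sup>2 * real k ^ k * (real q ^ (k + 1) * r ^ (2 * q))"
    (is "_ \<ge> 2 - exp ?X - ?Y")
proof -
  have k1: "real k \<ge> 1" and q0: "real q > 0" using l1 lk q2 by auto
  have r0: "r \<ge> 0" using \<rho> by simp
  have eta: "1 / \<eta> ^ l \<le> exp 1 ^ l / real q ^ l"
  proof -
    have "\<eta> ^ l = real k ^ l * real q ^ l / exp 1 ^ l"
      by (simp add: \<eta>_def power_divide power_mult_distrib)
    moreover have "1 * real q ^ l \<le> real k ^ l * real q ^ l"
      using k1 by (intro mult_right_mono one_le_power) auto
    ultimately have "real q ^ l \<le> exp 1 ^ l * \<eta> ^ l" by simp
    then show ?thesis using q0 eta_ge_1 by (simp add: pos_le_divide_eq pos_divide_le_eq)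
  qed
  have geo: "(\<Sum>b\<in>{1..<2 * q}. \<rho> ^ b) \<le> \<rho> / (1 - r)"
  proof -
    have "(\<Sum>b\<in>{1..<2 * q}. \<rho> ^ b) = (\<Sum>b<2 * q - 1. \<rho> ^ Suc b)"
      using q2 by (intro sum.reindex_bij_witness[of _ Suc "\<lambda>b. b - 1"]) auto
    also have "\<dots> = \<rho> * (\<Sum>b<2 * q - 1. \<rho> ^ b)" by (simp add: sum_distrib_left)
    also have "(\<Sum>b<2 * q - 1. \<rho> ^ b) = (1 - \<rho> ^ (2 * q - 1)) / (1 - \<rho>)"
      using \<rho> by (subst sum_gp_strict) auto
    also have "\<rho> * \<dots> \<le> \<rho> * (1 / (1 - r))"
      using \<rho> by (intro mult_left_mono frac_le) auto
    finally show ?thesis by simp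
  qed
  have X: "2 * real q * (\<Sum>b\<in>{1..<2 * q}. arc_cost \<rho> b) \<le> ?X"
  proof -
    have "2 * real q * (\<Sum>b\<in>{1..<2 * q}. arc_cost \<rho> b) =
        8 * (real q)\<^sup>2 * (fact k)\<^sup>2 * (1 / \<eta> ^ l) * (\<Sum>b\<in>{1..<2 * q}. \<rho> ^ b)"
      unfolding arc_cost_def sum_distrib_left[symmetric] by (simp add: power2_eq_square)
    also have "\<dots> \<le> 8 * (real q)\<^sup>2 * (fact k)\<^sup>2 * (exp 1 ^ l / real q ^ l) * (\<rho> / (1 - r))"
      using eta geo \<rho> by (intro mult_mono mult_left_mono sum_nonneg) auto
    also have "\<dots> = ?X" by (simp add: mult_ac)
    finally show ?thesis .
  qed
  have Y: "1 / p * arc_cost \<rho> (2 * q - 1) \<le> ?Y"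
  proof -
    \<comment> \<open>A crude polynomial bound on the scale is enough, since r^(2q) decays
      exponentially.\<close>
    have "\<eta> ^ k / L \<le> \<eta> ^ k"
    proof -
      have "1 * 1 \<le> L" unfolding L_def by (intro mult_mono) auto
      then show ?thesis using eta_ge_1 L_pos by (simp add: pos_divide_le_eq mult_left_le_imp_le mult_le_cancel_left1)
    qed
    also have "\<dots> \<le> (\<eta> ^ k)\<^sup>2"
      using eta_ge_1 by (intro self_le_power) auto
    finally have "sqrt (\<eta> ^ k / L) \<le> sqrt ((\<eta> ^ k)\<^sup>2)" by (rule real_sqrt_le_mono)
    also have "\<dots> = \<eta> ^ k" using eta_ge_1 by simp
    also have "\<dots> \<le> real n ^ k"
    proof (intro power_mono)
      have "real n * 1 \<le> real n * exp 1" by (intro mult_left_mono) auto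
      then show "\<eta> \<le> real n" by (simp add: \<eta>_def divide_le_eq)
    qed (use eta_ge_1 in simp)
    finally have s: "sqrt (\<eta> ^ k / L) \<le> real k ^ k * real q ^ k" by (simp add: power_mult_distrib)
    have "1 / p * arc_cost \<rho> (2 * q - 1) =
        sqrt (\<eta> ^ k / L) * (4 * real q * ((fact k)\<^sup>2 / \<eta> ^ l) * (\<rho> * \<rho> ^ (2 * q - 1)))"
      unfolding \<rho>(1) arc_cost_def by (simp only: mult_ac)
    \<comment> \<open>The \<rho> contained in 1/p completes the power 2q - 1 to 2q.\<close>
    also have "\<rho> * \<rho> ^ (2 * q - 1) = \<rho> ^ (2 * q)"
      using q2 by (simp flip: power_Suc)
    also have "sqrt (\<eta> ^ k / L) * (4 * real q * ((fact k)\<^sup>2 / \<eta> ^ l) * \<rho> ^ (2 * q)) \<le>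
        (real k ^ k * real q ^ k) * (4 * real q * ((fact k)\<^sup>2 / 1) * r ^ (2 * q))"
      using s eta_ge_1 \<rho> r0 L_pos
      by (intro mult_mono divide_left_mono power_mono) (auto simp: one_le_power)
    also have "\<dots> = ?Y" by (simp add: mult_ac)
    finally show ?thesis .
  qed
  have "measure_pmf.prob (random_hypergraph k n p) {H. \<exists>w\<in>orderings. cycle_edges w \<subseteq> H} \<ge> 1 - (exp ?X + ?Y - 1)"
  proof (rule prob_second_moment[where C = cycle_edges and m = "2 * q"])
    show "orderings \<noteq> {}" using card_orderings by auto
    fix v assume v: "v \<in> orderings"
    have "1 / p \<ge> 1" using p by simp
    then have "(\<Sum>w\<in>orderings. (1 / p) ^ card (cycle_edges v \<inter> cycle_edges w)) \<le>
        fact n * (exp (2 * real q * (\<Sum>b\<in>{1..<2 * q}. arc_cost \<rho> b)) + 1 / p * arc_cost \<rho> (2 * q - 1))"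
      by (rule sum_common_edges_le[OF v \<rho>(2,1)])
    also have "\<dots> \<le> fact n * (exp ?X + ?Y)"
      using X Y by (intro mult_left_mono add_mono) auto
    finally show "(\<Sum>w\<in>orderings. (1 / p) ^ card (cycle_edges v \<inter> cycle_edges w)) \<le> real (card orderings) * (1 + (exp ?X + ?Y - 1))"
      by (simp add: card_orderings)
  qed (use p finite_orderings cycle_edges_complete card_cycle_edges in auto)
  then show ?thesis unfolding offset_hamiltonian_iff by (simp add: algebra_simps)
qed

end

subsection \<open>Asymptotics\<close>

lemma power_times_geometric_tendsto_0:
  fixes r :: real
  assumes "0 \<le> r" "r < 1"
  shows "(\<lambda>q. real q ^ j * r ^ (2 * q)) \<longlonglongrightarrow> 0"
proof (cases "r = 0")
  case True
  have "eventually (\<lambda>q::nat. real q ^ j * r ^ (2 * q) = 0) sequentially"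
    using eventually_gt_at_top[of 0] by eventually_elim (simp add: True)
  then show ?thesis by (rule tendsto_eventually)
next
  case False
  \<comment> \<open>With this \<open>a\<close>, r^(2q) is exp (- a q), which reduces the claim to
    the limit of x^j / exp x.\<close>
  define a where "a = - (2 * ln r)"
  have a: "a > 0" using assms False by (simp add: a_def)
  have "((\<lambda>x. x ^ j / exp x) \<longlongrightarrow> 0) (at_top :: real filter)" by (rule tendsto_power_div_exp_0)
  moreover have "filterlim (\<lambda>q::nat. a * real q) at_top sequentially"
    using a by (intro filterlim_tendsto_pos_mult_at_top[OF tendsto_const] filterlim_real_sequentially)
  ultimately have "(\<lambda>q. (a * real q) ^ j / exp (a * real q)) \<longlonglongrightarrow> 0"
    by (rule filterlim_compose)
  then have "(\<lambda>q. (a * real q) ^ j / exp (a * real q) / a ^ j) \<longlonglongrightarrow> 0 / a ^ j"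
    by (intro tendsto_divide tendsto_const) (use a in auto)
  moreover have "(a * real q) ^ j / exp (a * real q) / a ^ j = real q ^ j * r ^ (2 * q)" for q
  proof -
    have "r ^ (2 * q) = exp (real (2 * q) * ln r)"
      using assms False by (simp add: exp_of_nat_mult del: of_nat_mult)
    also have "\<dots> = 1 / exp (a * real q)"
      by (simp add: a_def exp_minus[symmetric] inverse_eq_divide[symmetric])
    finally show ?thesis using a by (simp add: power_mult_distrib)
  qed
  ultimately show ?thesis by simp
qed

lemma filterlim_div_multiples:
  assumes "k > 0"
  shows "filterlim (\<lambda>n. n div k) sequentially (multiples_at_top k)"
  unfolding multiples_at_top_def
  by (rule filterlim_mono[OF filterlim_at_top_div_const_nat[OF assms] order_refl inf_le1])

lemma eventually_multiples:
  assumes "k > 0"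
  shows "eventually (\<lambda>n. n = k * (n div k) \<and> 2 \<le> n div k) (multiples_at_top k)"
proof -
  have "eventually (\<lambda>n. k dvd n) (multiples_at_top k)"
    by (simp add: multiples_at_top_def eventually_inf_principal)
  moreover have "eventually (\<lambda>n. 2 \<le> n div k) (multiples_at_top k)"
    using filterlim_div_multiples[OF assms] by (simp add: filterlim_at_top)
  ultimately show ?thesis by eventually_elim auto
qed

lemma random_hypergraph_clamp: "random_hypergraph k n p = random_hypergraph k n (min 1 (max 0 p))"
  unfolding random_hypergraph_def by (subst bernoulli_pmf_clamp) (rule refl)

lemma threshold_scale_at_top:
  assumes "k > 0"
  shows "filterlim (\<lambda>n. sqrt ((real n / exp 1) ^ k / (fact l * fact (k - l)))) at_top (multiples_at_top k)"
proof -
  have "filterlim (\<lambda>n. sqrt (1 / (exp 1 ^ k * (fact l * fact (k - l))) * real n ^ k)) at_top sequentially"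
    by (intro filterlim_compose[OF sqrt_at_top] filterlim_tendsto_pos_mult_at_top[OF tendsto_const]
        filterlim_pow_at_top filterlim_real_sequentially assms) simp
  then have "filterlim (\<lambda>n. sqrt ((real n / exp 1) ^ k / (fact l * fact (k - l)))) at_top sequentially"
    by (simp add: power_divide mult.commute)
  then show ?thesis
    unfolding multiples_at_top_def by (rule filterlim_mono[OF _ order_refl inf_le1])
qed

text \<open>For n > 0, \<open>A n\<close> is the reciprocal of the threshold, so
  \<open>p n * A n\<close> is the ratio of p to it. Truncating p at 1 turns this ratio into
  \<open>min (A n) (p n * A n)\<close>, whose reciprocal is the \<rho> of the fixed-n bound.\<close>

lemma aas_offset_hamiltonian:
  fixes p A :: "nat \<Rightarrow> real"
  assumes l: "1 \<le> l" "2 * l \<le> k"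
    and A: "\<And>n. A n = sqrt ((real n / exp 1) ^ k / (fact l * fact (k - l)))"
    and s: "s > 1" "eventually (\<lambda>n. s \<le> p n * A n) (multiples_at_top k)"
    and lim: "((\<lambda>n. (real (n div k))\<^sup>2 / real (n div k) ^ l * (1 / min (A n) (p n * A n))) \<longlongrightarrow> 0)
      (multiples_at_top k)"
  shows "aas k p (\<lambda>n H. offset_hamiltonian k l {1..n} H)"
proof -
  let ?F = "multiples_at_top k"
  have k: "k > 0" using l by simp
  define r where "r = 1 / s"
  have r: "0 \<le> r" "r < 1" using s(1) by (auto simp: r_def)
  define \<rho> where "\<rho> n = 1 / min (A n) (p n * A n)" for n
  define lb where "lb n = 2 - exp (8 * (fact k)\<^sup>2 * exp 1 ^ l / (1 - r) *
      ((real (n div k))\<^sup>2 / real (n div k) ^ l * \<rho> n))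
      - 4 * (fact k)\<^sup>2 * real k ^ k * (real (n div k) ^ (k + 1) * r ^ (2 * (n div k)))" for n
  have "(lb \<longlongrightarrow> 2 - exp (8 * (fact k)\<^sup>2 * exp 1 ^ l / (1 - r) * 0) - 4 * (fact k)\<^sup>2 * real k ^ k * 0) ?F"
    unfolding lb_def
    by (intro tendsto_intros filterlim_compose[OF power_times_geometric_tendsto_0[OF r]
          filterlim_div_multiples[OF k]] lim[folded \<rho>_def])
  then have lb: "(lb \<longlongrightarrow> 1) ?F" by simp
  \<comment> \<open>Since \<open>A\<close> tends to infinity, the ratio stays at least
    \<open>s\<close> even where p is truncated; hence \<rho> \<le> 1/s.\<close>
  have "eventually (\<lambda>n. s \<le> A n) ?F"
    using threshold_scale_at_top[OF k, of l] unfolding A[symmetric, abs_def] by (simp add: filterlim_at_top A)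
  then have "eventually (\<lambda>n. lb n \<le> measure_pmf.prob (random_hypergraph k n (p n))
      {H. offset_hamiltonian k l {1..n} H}) ?F"
    using s(2) eventually_multiples[OF k]
  proof eventually_elim
    case (elim n)
    define q where "q = n div k"
    have n: "n = k * q" and q: "2 \<le> q" using elim by (auto simp: q_def)
    interpret offset_setup k l q by unfold_locales (use l q in auto)
    have An: "A n = sqrt (\<eta> ^ k / L)" by (simp add: A n \<eta>_def L_def)
    have A0: "A n > 0" using elim(1) s(1) by linarith
    have p0: "p n > 0" using elim(2) s(1) A0 by (metis less_trans less_le_trans zero_less_mult_pos2 zero_less_one)
    have min: "min 1 (max 0 (p n)) = min 1 (p n)" using p0 by simp
    have "min 1 (p n) * A n = min (A n) (p n * A n)" using A0 by (simp add: min_mult_distrib_right)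
    then have \<rho>n: "\<rho> n = 1 / (min 1 (p n) * A n)" by (simp add: \<rho>_def)
    have "\<rho> n \<le> r"
      unfolding \<rho>_def r_def using elim s(1) by (intro divide_left_mono) auto
    moreover have "0 \<le> \<rho> n" using A0 p0 by (simp add: \<rho>n)
    moreover have "1 / min 1 (p n) = \<rho> n * sqrt (\<eta> ^ k / L)"
      unfolding \<rho>n An[symmetric] using A0 by simp
    ultimately show ?case
      using prob_hamiltonian_lower[of "min 1 (p n)" "\<rho> n" r] p0 r(2)
      unfolding random_hypergraph_clamp[of k n "p n"] min lb_def q_def[symmetric]
      by (simp add: n)
  qed
  then show ?thesis
    unfolding aas_def
    by (intro tendsto_sandwich[OF _ _ lb tendsto_const]) auto
qed

text \<open>Assuming an upper bound on \<open>p\<close> with a nonnegative \<open>c\<close>, instead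
  of an equation, also covers edge probabilities that are negative.\<close>

lemma aas_not_offset_hamiltonian:
  fixes p :: "nat \<Rightarrow> real"
  assumes l: "1 \<le> l" "2 * l \<le> k" and c: "0 \<le> c" "c < 1"
    and p: "\<And>n. p n \<le> c * sqrt (exp 1 ^ k * fact l * fact (k - l) / real n ^ k)"
  shows "aas k p (\<lambda>n H. \<not> offset_hamiltonian k l {1..n} H)"
proof -
  let ?F = "multiples_at_top k"
  have k: "k > 0" using l by simp
  \<comment> \<open>The first moment bound with n! \<le> e n (n/e)^n cancels to e n c^(2q), where n
    = k q.\<close>
  define ub where "ub n = 1 - exp 1 * real k * (real (n div k) ^ 1 * c ^ (2 * (n div k)))" for n
  have "(ub \<longlongrightarrow> 1 - exp 1 * real k * 0) ?F"
    unfolding ub_def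
    by (intro tendsto_intros filterlim_compose[OF power_times_geometric_tendsto_0[OF c]
          filterlim_div_multiples[OF k]])
  then have ub: "(ub \<longlongrightarrow> 1) ?F" by simp
  have "eventually (\<lambda>n. ub n \<le> measure_pmf.prob (random_hypergraph k n (p n))
      {H. \<not> offset_hamiltonian k l {1..n} H}) ?F"
    using eventually_multiples[OF k]
  proof eventually_elim
    case (elim n)
    define q where "q = n div k"
    have n: "n = k * q" and q: "2 \<le> q" using elim by (auto simp: q_def)
    interpret offset_setup k l q by unfold_locales (use l q in auto)
    define y where "y = min 1 (max 0 (p n))"
    have y: "0 \<le> y" "y \<le> 1" by (auto simp: y_def)
    have n0: "real n > 0" using n q k by simp
    let ?R = "exp 1 ^ k * L / real n ^ k"
    have R0: "?R \<ge> 0" using L_pos by simp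
    have "y \<le> c * sqrt ?R"
      using p[of n] c(1) R0 by (auto simp: y_def L_def mult.assoc min_le_iff_disj)
    then have "y ^ (2 * q) \<le> (c * sqrt ?R) ^ (2 * q)" by (rule power_mono) (rule y)
    also have "\<dots> = c ^ (2 * q) * ?R ^ q"
      unfolding power_mult_distrib[of c] power_mult[of "sqrt ?R"] using R0 by (simp only: real_sqrt_pow2)
    also have "?R ^ q = exp 1 ^ n * L ^ q / real n ^ n"
      by (simp add: power_divide power_mult_distrib power_mult[symmetric] n)
    finally have yq: "y ^ (2 * q) \<le> c ^ (2 * q) * (exp 1 ^ n * L ^ q / real n ^ n)" .
    have "measure_pmf.prob (random_hypergraph k n y) {H. offset_hamiltonian k l {1..n} H} \<le>
        fact n * y ^ (2 * q) / L ^ q"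
      using prob_hamiltonian_upper[OF y] by (simp add: L_def n)
    also have "\<dots> \<le> fact n * (c ^ (2 * q) * (exp 1 ^ n * L ^ q / real n ^ n)) / L ^ q"
      using yq L_pos by (intro divide_right_mono mult_left_mono) auto
    also have "\<dots> = fact n * (c ^ (2 * q) * (exp 1 ^ n / real n ^ n))"
      using L_pos by simp
    also have "\<dots> \<le> (exp 1 * real n * (real n / exp 1) ^ n) * (c ^ (2 * q) * (exp 1 ^ n / real n ^ n))"
      using n0 c by (intro mult_right_mono fact_upper) auto
    also have "\<dots> = exp 1 * real k * (real q ^ 1 * c ^ (2 * q))"
      using n0 by (auto simp: power_divide n)
    finally have "measure_pmf.prob (random_hypergraph k n y) {H. offset_hamiltonian k l {1..n} H} \<le>
        1 - ub n" by (simp add: ub_def q_def)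
    moreover have "measure_pmf.prob (random_hypergraph k n y) {H. \<not> offset_hamiltonian k l {1..n} H} =
        1 - measure_pmf.prob (random_hypergraph k n y) {H. offset_hamiltonian k l {1..n} H}"
      by (subst measure_pmf.prob_compl[symmetric]) (auto intro!: arg_cong[where f = "measure_pmf.prob _"])
    ultimately show ?case
      unfolding random_hypergraph_clamp[of k n "p n"] y_def[symmetric] by simp
  qed
  then show ?thesis
    unfolding aas_def
    by (intro tendsto_sandwich[OF _ _ ub tendsto_const]) auto
qed

lemma threshold_scale_mult:
  assumes "n > 0"
  shows "sqrt (exp 1 ^ k * fact l * fact (k - l) / real n ^ k) *
    sqrt ((real n / exp 1) ^ k / (fact l * fact (k - l))) = 1"
proof -
  have "exp 1 ^ k * fact l * fact (k - l) / real n ^ k * ((real n / exp 1) ^ k / (fact l * fact (k - l))) = 1"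
    using assms by (simp add: power_divide)
  then show ?thesis by (simp only: real_sqrt_mult[symmetric] real_sqrt_one)
qed

lemma aas_above_threshold:
  fixes \<epsilon> :: real
  assumes "\<epsilon> > 0" and l: "3 \<le> l" "2 * l \<le> k"
  shows "aas k (\<lambda>n. (1 + \<epsilon>) * sqrt (exp 1 ^ k * fact l * fact (k - l) / real n ^ k))
    (\<lambda>n H. offset_hamiltonian k l {1..n} H)"
proof -
  let ?F = "multiples_at_top k"
  define A where "A n = sqrt ((real n / exp 1) ^ k / (fact l * fact (k - l)))" for n :: nat
  define p where "p n = (1 + \<epsilon>) * sqrt (exp 1 ^ k * fact l * fact (k - l) / real n ^ k)" for n :: nat
  have k: "k > 0" using l by simp
  have pA: "eventually (\<lambda>n. p n * A n = 1 + \<epsilon>) ?F"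
    using eventually_multiples[OF k]
  proof eventually_elim
    case (elim n)
    then have n: "n > 0" by (intro gr0I) auto
    show ?case
      unfolding p_def A_def by (subst mult.assoc) (simp only: threshold_scale_mult[OF n] mult_1_right)
  qed
  have "filterlim A at_top ?F"
    unfolding A_def[abs_def] by (rule threshold_scale_at_top[OF k])
  then have A1: "eventually (\<lambda>n. 1 \<le> A n) ?F" by (simp add: filterlim_at_top)
  define g where "g n = (real (n div k))\<^sup>2 / real (n div k) ^ l * (1 / min (A n) (p n * A n))" for n
  \<comment> \<open>The minimum is at least 1, and l \<ge> 3 gives q^2 / q^l \<le> 1/q; a bounded
    \<rho> therefore suffices.\<close>
  have bounds: "eventually (\<lambda>n. 0 \<le> g n \<and> g n \<le> 1 / real (n div k)) ?F"
    using pA A1 eventually_multiples[OF k]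
  proof eventually_elim
    case (elim n)
    let ?x = "real (n div k)"
    have x: "?x \<ge> 1" using elim by simp
    have M: "min (A n) (p n * A n) \<ge> 1" using elim assms(1) by simp
    have "?x\<^sup>2 / ?x ^ l \<le> ?x\<^sup>2 / ?x ^ 3"
      using x l by (intro divide_left_mono power_increasing mult_pos_pos) auto
    also have "\<dots> = 1 / ?x" using x by (simp add: power2_eq_square power3_eq_cube)
    finally have "?x\<^sup>2 / ?x ^ l * (1 / min (A n) (p n * A n)) \<le> 1 / ?x * 1"
      using M x by (intro mult_mono) (auto simp: divide_le_eq)
    moreover have "0 \<le> ?x\<^sup>2 / ?x ^ l * (1 / min (A n) (p n * A n))"
      using M x by (intro mult_nonneg_nonneg divide_nonneg_nonneg) auto
    ultimately show ?case by (simp add: g_def)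
  qed
  have "(\<lambda>q. 1 / real q) \<longlonglongrightarrow> 0" by (rule lim_1_over_n)
  then have h: "((\<lambda>n. 1 / real (n div k)) \<longlongrightarrow> 0) ?F"
    by (rule filterlim_compose[OF _ filterlim_div_multiples[OF k]])
  have "(g \<longlongrightarrow> 0) ?F"
  proof (rule tendsto_sandwich[of "\<lambda>_. 0" g ?F "\<lambda>n. 1 / real (n div k)" 0])
    show "eventually (\<lambda>n. 0 \<le> g n) ?F" using bounds by (rule eventually_mono) simp
    show "eventually (\<lambda>n. g n \<le> 1 / real (n div k)) ?F" using bounds by (rule eventually_mono) simp
  qed (use h in simp_all)
  moreover have "eventually (\<lambda>n. 1 + \<epsilon> \<le> p n * A n) ?F"
    using pA by (rule eventually_mono) simp
  ultimately have "aas k p (\<lambda>n H. offset_hamiltonian k l {1..n} H)"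
    unfolding g_def[abs_def] using l assms(1)
    by (intro aas_offset_hamiltonian[OF _ _ A_def, where s = "1 + \<epsilon>"]) simp_all
  then show ?thesis unfolding p_def[abs_def] .
qed

text \<open>For l = 2 the factor q^2 / q^l is 1, so the decay has to come from \<rho>, which tends
  to 0 because both \<omega> and the scale \<open>A\<close> tend to infinity.\<close>

lemma aas_two_offset:
  fixes \<omega> :: "nat \<Rightarrow> real"
  assumes k4: "4 \<le> k" and \<omega>: "filterlim \<omega> at_top (multiples_at_top k)"
  shows "aas k (\<lambda>n. \<omega> n / real n powr (real k / 2)) (\<lambda>n H. offset_hamiltonian k 2 {1..n} H)"
proof -
  let ?F = "multiples_at_top k"
  define A where "A n = sqrt ((real n / exp 1) ^ k / (fact 2 * fact (k - 2)))" for n :: nat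
  define p where "p n = \<omega> n / real n powr (real k / 2)" for n :: nat
  \<comment> \<open>The constant in A = n^(k/2) / K, chosen so that p A = \<omega> / K.\<close>
  define K where "K = sqrt (exp 1 ^ k * (fact 2 * fact (k - 2)))"
  have k: "k > 0" using k4 by simp
  have K: "K > 0" by (simp add: K_def)
  have pA: "eventually (\<lambda>n. 1 / K * \<omega> n = p n * A n) ?F"
    using eventually_multiples[OF k]
  proof eventually_elim
    case (elim n)
    then have "n > 0" by (intro gr0I) auto
    then have n: "real n > 0" by simp
    have "real n powr (real k / 2) = sqrt (real n ^ k)"
      using n by (simp add: powr_half_sqrt[symmetric] powr_realpow[symmetric] powr_powr)
    moreover have "A n = sqrt (real n ^ k) / K"
      by (simp add: A_def K_def power_divide real_sqrt_divide real_sqrt_mult)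
    ultimately show ?case using n by (simp add: p_def)
  qed
  have A_top: "filterlim A at_top ?F"
    unfolding A_def[abs_def] by (rule threshold_scale_at_top[OF k])
  have "filterlim (\<lambda>n. 1 / K * \<omega> n) at_top ?F"
    using K by (intro filterlim_tendsto_pos_mult_at_top[OF tendsto_const _ \<omega>]) simp
  then have pA_top: "filterlim (\<lambda>n. p n * A n) at_top ?F"
    by (rule filterlim_cong[OF refl refl pA, THEN iffD1])
  have min_top: "filterlim (\<lambda>n. min (A n) (p n * A n)) at_top ?F"
    unfolding filterlim_at_top
  proof
    fix Z
    have "eventually (\<lambda>n. Z \<le> A n) ?F" "eventually (\<lambda>n. Z \<le> p n * A n) ?F"
      using A_top pA_top by (auto simp: filterlim_at_top)
    then show "eventually (\<lambda>n. Z \<le> min (A n) (p n * A n)) ?F"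
      by eventually_elim simp
  qed
  have "((\<lambda>n. 1 / min (A n) (p n * A n)) \<longlongrightarrow> 0) ?F"
    by (rule tendsto_divide_0[OF tendsto_const filterlim_at_top_imp_at_infinity[OF min_top]])
  moreover have "eventually (\<lambda>n. 1 / min (A n) (p n * A n) =
      (real (n div k))\<^sup>2 / real (n div k) ^ 2 * (1 / min (A n) (p n * A n))) ?F"
    using eventually_multiples[OF k] by eventually_elim simp
  ultimately have "((\<lambda>n. (real (n div k))\<^sup>2 / real (n div k) ^ 2 * (1 / min (A n) (p n * A n))) \<longlongrightarrow> 0) ?F"
    by (rule Lim_transform_eventually)
  moreover have "eventually (\<lambda>n. 2 \<le> p n * A n) ?F"
    using pA_top by (auto simp: filterlim_at_top)
  ultimately have "aas k p (\<lambda>n H. offset_hamiltonian k 2 {1..n} H)"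
    using k4 by (intro aas_offset_hamiltonian[OF _ _ A_def, where s = 2]) simp_all
  then show ?thesis unfolding p_def[abs_def] .
qed

theorem theorem4:
  fixes \<epsilon> :: real
  assumes "\<epsilon> > 0"
  shows
    "(\<forall>k l :: nat. k \<ge> 3 \<longrightarrow> 1 \<le> l \<longrightarrow> 2 * l \<le> k \<longrightarrow>
        aas k (\<lambda>n. (1 - \<epsilon>) * sqrt (exp 1 ^ k * fact l * fact (k - l) / real n ^ k))
          (\<lambda>n H. \<not> offset_hamiltonian k l {1..n} H))
   \<and> (\<forall>k l :: nat. k \<ge> 6 \<longrightarrow> 3 \<le> l \<longrightarrow> 2 * l \<le> k \<longrightarrow>
        aas k (\<lambda>n. (1 + \<epsilon>) * sqrt (exp 1 ^ k * fact l * fact (k - l) / real n ^ k))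
          (\<lambda>n H. offset_hamiltonian k l {1..n} H))
   \<and> (\<forall>(k :: nat) (\<omega> :: nat \<Rightarrow> real). k \<ge> 4 \<longrightarrow>
        filterlim \<omega> at_top (multiples_at_top k) \<longrightarrow>
        aas k (\<lambda>n. \<omega> n / real n powr (real k / 2))
          (\<lambda>n H. offset_hamiltonian k 2 {1..n} H))"
proof (intro conjI allI impI)
  fix k l :: nat
  assume "k \<ge> 3" "1 \<le> l" "2 * l \<le> k"
  \<comment> \<open>The maximum with 0 keeps \<open>c\<close> nonnegative when \<epsilon> exceeds
    1.\<close>
  then show "aas k (\<lambda>n. (1 - \<epsilon>) * sqrt (exp 1 ^ k * fact l * fact (k - l) / real n ^ k))
      (\<lambda>n H. \<not> offset_hamiltonian k l {1..n} H)"
    using assms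
    by (intro aas_not_offset_hamiltonian[where c = "max 0 (1 - \<epsilon>)"] mult_right_mono) auto
next
  fix k l :: nat
  assume "k \<ge> 6" "3 \<le> l" "2 * l \<le> k"
  then show "aas k (\<lambda>n. (1 + \<epsilon>) * sqrt (exp 1 ^ k * fact l * fact (k - l) / real n ^ k))
      (\<lambda>n H. offset_hamiltonian k l {1..n} H)"
    using assms by (intro aas_above_threshold)
next
  fix k :: nat and \<omega> :: "nat \<Rightarrow> real"
  assume "k \<ge> 4" "filterlim \<omega> at_top (multiples_at_top k)"
  then show "aas k (\<lambda>n. \<omega> n / real n powr (real k / 2))
      (\<lambda>n H. offset_hamiltonian k 2 {1..n} H)"
    by (rule aas_two_offset)
qed

end
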